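(* Let $n\ge 2$, let $U$ be a simply connected open domain with coordinates $u^1,\dots,u^n$, and let $\mathbf r:U\to\mathbb R^{n+1}$ be a smooth hypersurface $M^n\subset A^{n+1}$ (with $\mathbf r,\mathbf r_1,\dots,\mathbf r_n$ linearly independent at every point) whose centroaffine metric is nondegenerate and flat, the coordinates being chosen flat, so that $g_{ij}=\eta_{ij}$ is a constant nondegenerate symmetric matrix with inverse $\eta^{ij}$. Then there is a smooth function $f$ on $U$ such that $$h^s_{ij}=\eta^{sk}\,\partial_i\partial_j\partial_k f ,$$ and $f$ satisfies the equations of associativity in the following sense. Put $$F(u^0,u^1,\dots,u^n)=\tfrac16 (u^0)^3+\tfrac12\,\eta_{ij}u^0u^iu^j+f(u^1,\dots,u^n)$$ and let indices $\alpha,\beta,\gamma,\delta$ run over $0,1,\dots,n$. Then the matrix $\eta_{\alpha\beta}=\partial_0\partial_\alpha\partial_\beta F$ is constant and nondegenerate, and at every point the functions $c^\alpha_{\beta\gamma}=\eta^{\alpha\delta}\,\partial_\beta\partial_\gamma\partial_\delta F$ are the structure constants of a commutative associative algebra. More precisely, for a constant nondegenerate symmetric matrix $\eta_{ij}$ and smooth functions $h^s_{ij}=h^s_{ji}$ on $U$, the centroaffine Gauss--Codazzi equations with $g_{ij}=\eta_{ij}$ hold if and only if $h^s_{ij}=\eta^{sk}\partial_i\partial_j\partial_k f$ for some smooth function $f$ on $U$ such that the functions $c^\alpha_{\beta\gamma}=\eta^{\alpha\delta}\,\partial_\beta\partial_\gamma\partial_\delta F$, where $F=\tfrac16 (u^0)^3+\tfrac12\,\eta_{ij}u^0u^iu^j+f(u^1,\dots,u^n)$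 and $\eta_{\alpha\beta}=\partial_0\partial_\alpha\partial_\beta F$, are, at every point, the structure constants of a commutative associative algebra. In particular, for $n=2$, with coordinates $x=u^1$, $y=u^2$ such that the flat centroaffine metric is $\eta_{ij}du^idu^j=2\,dx\,dy$ (so that $x,y$ are asymptotic coordinates on $M^2\subset A^3$), the condition on $f$ is equivalent to the single equation $$f_{xxx}f_{yyy}-f_{xxy}f_{xyy}=1 .$$
   Context: Summation over repeated indices is understood; Latin indices run over $1,\dots,n$; $\partial_i=\partial/\partial u^i$ and $\partial_0=\partial/\partial u^0$; $\eta^{\alpha\beta}$ denotes the inverse of $\eta_{\alpha\beta}$. Centroaffine geometry: for a hypersurface with position vector $\mathbf r(u^1,\dots,u^n)\in\mathbb R^{n+1}$ such that $\mathbf r,\mathbf r_1,\dots,\mathbf r_n$ are linearly independent ($\mathbf r_i=\partial_i\mathbf r$, $\mathbf r_{ij}=\partial_i\partial_j\mathbf r$), there are unique functions $\tilde\Gamma^k_{ij}=\tilde\Gamma^k_{ji}$ and $g_{ij}=g_{ji}$ with $$\mathbf r_{ij}=\tilde\Gamma^k_{ij}\,\mathbf r_k+g_{ij}\,\mathbf r .$$ The symmetric form $M=g_{ij}du^idu^j$ is the centroaffine metric (assumed nondegenerate, of any signature). Let $\Gamma^k_{ij}$ be its Levi-Civita connection and $h^k_{ij}=\tilde\Gamma^k_{ij}-\Gamma^k_{ij}$. The compatibility conditions of the linear system $\mathbf r_{ij}=\tilde\Gamma^k_{ij}\,\mathbf r_k+g_{ij}\,\mathbf r$ are the centroaffine Gauss--Codazzi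 equations $$h^s_{ij}g_{sk}=h^s_{ik}g_{sj},\qquad \nabla_kh^s_{ij}=\nabla_jh^s_{ik},\qquad R^s_{ijk}+h^p_{ij}h^s_{pk}-h^p_{ik}h^s_{pj}=g_{ik}\delta^s_j-g_{ij}\delta^s_k,$$ where $\nabla$ is the Levi-Civita covariant derivative of $g$ and $R^s_{ijk}=\partial_k\Gamma^s_{ij}-\partial_j\Gamma^s_{ik}+\Gamma^p_{ij}\Gamma^s_{pk}-\Gamma^p_{ik}\Gamma^s_{pj}$. In flat coordinates of a flat metric, $g_{ij}=\eta_{ij}$ is constant, $\Gamma=0$, $\tilde\Gamma=h$, and these equations become $$h^s_{ij}\eta_{sk}=h^s_{ik}\eta_{sj},\qquad \partial_kh^s_{ij}=\partial_jh^s_{ik},\qquad h^p_{ij}h^s_{pk}-h^p_{ik}h^s_{pj}=\eta_{ik}\delta^s_j-\eta_{ij}\delta^s_k .$$ "Structure constants of a commutative associative algebra" means that the bilinear product $e_\beta\cdot e_\gamma=c^\alpha_{\beta\gamma}e_\alpha$ on the vector space with basis $e_0,\dots,e_n$ is commutative and associative. *)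

theory Defs
  imports "HOL-Analysis.Analysis"
begin

section \<open>Smooth functions and partial derivatives\<close>

primrec C_k_on ::
    "nat \<Rightarrow> 'a::real_normed_vector set \<Rightarrow> ('a \<Rightarrow> 'b::real_normed_vector) \<Rightarrow> bool" where
  "C_k_on 0 S f \<longleftrightarrow> continuous_on S f"
| "C_k_on (Suc k) S f \<longleftrightarrow>
     (\<forall>x\<in>S. f differentiable (at x)) \<and>
     (\<forall>v. C_k_on k S (\<lambda>x. frechet_derivative f (at x) v))"

text \<open>Only meant for open sets \<open>S\<close>.\<close>

definition smooth_on ::
    "'a::real_normed_vector set \<Rightarrow> ('a \<Rightarrow> 'b::real_normed_vector) \<Rightarrow> bool" where
  "smooth_on S f \<longleftrightarrow> (\<forall>k. C_k_on k S f)"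

definition partial ::
    "'n::finite \<Rightarrow> (real^'n \<Rightarrow> 'b::real_normed_vector) \<Rightarrow> real^'n \<Rightarrow> 'b" where
  "partial i f u = frechet_derivative f (at u) (axis i 1)"


section \<open>Metrics, Christoffel symbols, curvature\<close>

text \<open>
  Tensor indices are written as arguments, upper index first: \<open>h s i j u\<close> stands for
  the component of \<open>h\<close> with upper index \<open>s\<close> and lower indices \<open>i\<close>, \<open>j\<close> at the point \<open>u\<close>.
\<close>

type_synonym 'n metric = "real^'n \<Rightarrow> real^'n^'n"
type_synonym 'n tensor12 = "'n \<Rightarrow> 'n \<Rightarrow> 'n \<Rightarrow> real^'n \<Rightarrow> real"

definition delta :: "'a \<Rightarrow> 'a \<Rightarrow> real" where
  "delta i j = (if i = j then 1 else 0)"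

definition christoffel :: "'n::finite metric \<Rightarrow> 'n tensor12" where
  "christoffel g k i j u =
     1/2 * (\<Sum>l\<in>UNIV. matrix_inv (g u) $ k $ l *
       (partial i (\<lambda>v. g v $ l $ j) u + partial j (\<lambda>v. g v $ l $ i) u
        - partial l (\<lambda>v. g v $ i $ j) u))"

definition riemann ::
    "'n::finite metric \<Rightarrow> 'n \<Rightarrow> 'n \<Rightarrow> 'n \<Rightarrow> 'n \<Rightarrow> real^'n \<Rightarrow> real" where
  "riemann g s i j k u =
     partial k (christoffel g s i j) u - partial j (christoffel g s i k) u
     + (\<Sum>p\<in>UNIV. christoffel g p i j u * christoffel g s p k u)
     - (\<Sum>p\<in>UNIV. christoffel g p i k u * christoffel g s p j u)"

definition cov_deriv ::
    "'n::finite metric \<Rightarrow> 'n tensor12 \<Rightarrow> 'n \<Rightarrow> 'n tensor12" where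
  "cov_deriv g h k s i j u =
     partial k (h s i j) u
     + (\<Sum>p\<in>UNIV. christoffel g s p k u * h p i j u)
     - (\<Sum>p\<in>UNIV. christoffel g p i k u * h s p j u)
     - (\<Sum>p\<in>UNIV. christoffel g p j k u * h s i p u)"

definition gauss_codazzi ::
    "(real^'n::finite) set \<Rightarrow> 'n metric \<Rightarrow> 'n tensor12 \<Rightarrow> bool" where
  "gauss_codazzi U g h \<longleftrightarrow>
     (\<forall>u\<in>U. \<forall>i j k.
        (\<Sum>s\<in>UNIV. h s i j u * g u $ s $ k) = (\<Sum>s\<in>UNIV. h s i k u * g u $ s $ j)) \<and>
     (\<forall>u\<in>U. \<forall>s i j k. cov_deriv g h k s i j u = cov_deriv g h j s i k u) \<and>
     (\<forall>u\<in>U. \<forall>s i j k.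
        riemann g s i j k u
        + (\<Sum>p\<in>UNIV. h p i j u * h s p k u) - (\<Sum>p\<in>UNIV. h p i k u * h s p j u)
        = g u $ i $ k * delta s j - g u $ i $ j * delta s k)"


section \<open>Centroaffine hypersurfaces\<close>

fun frame ::
    "(real^'n::finite \<Rightarrow> real^'m::finite) \<Rightarrow> real^'n \<Rightarrow> 'n option \<Rightarrow> real^'m" where
  "frame r u None = r u"
| "frame r u (Some i) = partial i r u"

definition centroaffine_hypersurface ::
    "(real^'n::finite) set \<Rightarrow> (real^'n \<Rightarrow> real^'m::finite) \<Rightarrow> bool" where
  "centroaffine_hypersurface U r \<longleftrightarrow>
     smooth_on U r \<and> (\<forall>u\<in>U. inj (frame r u) \<and> independent (range (frame r u)))"

text \<open>
  The pair of the coefficient vector of the second derivative with respect to the tangent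
  vectors and its coefficient with respect to the position vector. It is well defined for
  hypersurfaces in a space of dimension \<open>n + 1\<close>, see \<open>centroaffine_coeffs_exists_unique\<close>.
\<close>

definition centroaffine_coeffs ::
    "(real^'n::finite \<Rightarrow> real^'m::finite) \<Rightarrow> 'n \<Rightarrow> 'n \<Rightarrow> real^'n \<Rightarrow> (real^'n) \<times> real" where
  "centroaffine_coeffs r i j u =
     (THE p. partial i (partial j r) u =
        (\<Sum>k\<in>UNIV. fst p $ k *\<^sub>R partial k r u) + snd p *\<^sub>R r u)"

definition centroaffine_connection ::
    "(real^'n::finite \<Rightarrow> real^'m::finite) \<Rightarrow> 'n tensor12" where
  "centroaffine_connection r k i j u = fst (centroaffine_coeffs r i j u) $ k"

definition centroaffine_metric ::
    "(real^'n::finite \<Rightarrow> real^'m::finite) \<Rightarrow> 'n metric" where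
  "centroaffine_metric r u = (\<chi> i j. snd (centroaffine_coeffs r i j u))"

definition centroaffine_h ::
    "(real^'n::finite \<Rightarrow> real^'m::finite) \<Rightarrow> 'n tensor12" where
  "centroaffine_h r k i j u =
     centroaffine_connection r k i j u - christoffel (centroaffine_metric r) k i j u"

text \<open>
  The coordinate directions are asymptotic: the second fundamental form vanishes on them,
  i.e. the second derivative along each coordinate line is tangent to the hypersurface.
\<close>

definition asymptotic_coordinates ::
    "(real^'n::finite) set \<Rightarrow> (real^'n \<Rightarrow> real^'m::finite) \<Rightarrow> bool" where
  "asymptotic_coordinates U r \<longleftrightarrow>
     (\<forall>u\<in>U. \<forall>i. partial i (partial i r) u \<in> span (range (\<lambda>k. partial k r u)))"

lemma sum_option_UNIV:
  fixes f :: "'n::finite option \<Rightarrow> 'b::comm_monoid_add"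
  shows "(\<Sum>a\<in>UNIV. f a) = f None + (\<Sum>i\<in>UNIV. f (Some i))"
proof -
  have "(\<Sum>a\<in>UNIV. f a) = f None + (\<Sum>a\<in>range Some. f a)"
    by (simp add: UNIV_option_conv)
  also have "(\<Sum>a\<in>range Some. f a) = (\<Sum>i\<in>UNIV. f (Some i))"
    by (subst sum.reindex) (auto simp: o_def)
  finally show ?thesis .
qed

lemma centroaffine_coeffs_exists_unique:
  fixes r :: "real^'n::finite \<Rightarrow> real^'m::finite"
  assumes dim: "CARD('m) = CARD('n) + 1"
    and hyp: "centroaffine_hypersurface U r" and u: "u \<in> U"
  shows "\<exists>!p. w = (\<Sum>k\<in>UNIV. fst p $ k *\<^sub>R partial k r u) + snd p *\<^sub>R r u"
proof -
  let ?v = "frame r u"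
  have inj: "inj ?v" and ind: "independent (range ?v)"
    using hyp u by (auto simp: centroaffine_hypersurface_def)
  have sum_frame: "(\<Sum>x\<in>range ?v. c x *\<^sub>R x) =
      (\<Sum>k\<in>UNIV. c (?v (Some k)) *\<^sub>R partial k r u) + c (?v None) *\<^sub>R r u" for c
    using inj by (simp add: sum.reindex sum_option_UNIV add.commute)
  have "card (range ?v) = DIM(real^'m)"
    using inj dim by (simp add: card_image card_UNIV_option)
  then have "UNIV \<subseteq> span (range ?v)"
    using ind by (intro card_ge_dim_independent) auto
  then have "w \<in> span (range ?v)"
    by blast
  also have "span (range ?v) = range (\<lambda>c. \<Sum>x\<in>range ?v. c x *\<^sub>R x)"
    by (rule span_finite) simp
  finally obtain c where "w = (\<Sum>x\<in>range ?v. c x *\<^sub>R x)"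
    by blast
  then have ex: "w = (\<Sum>k\<in>UNIV. fst ((\<chi> k. c (?v (Some k))), c (?v None)) $ k *\<^sub>R partial k r u)
      + snd ((\<chi> k. c (?v (Some k))) :: real^'n, c (?v None)) *\<^sub>R r u"
    unfolding sum_frame by (simp only: frame.simps fst_conv snd_conv vec_lambda_beta)
  have uniq: "p = q"
    if p: "w = (\<Sum>k\<in>UNIV. fst p $ k *\<^sub>R partial k r u) + snd p *\<^sub>R r u"
      and q: "w = (\<Sum>k\<in>UNIV. fst q $ k *\<^sub>R partial k r u) + snd q *\<^sub>R r u"
    for p q :: "(real^'n) \<times> real"
  proof -
    define d where
      "d x = (case inv ?v x of None \<Rightarrow> snd p - snd q | Some k \<Rightarrow> fst p $ k - fst q $ k)" for x
    have dN: "d (r u) = snd p - snd q"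
      using inv_f_f[OF inj, of None] by (simp add: d_def)
    have dS: "d (partial k r u) = fst p $ k - fst q $ k" for k
      using inv_f_f[OF inj, of "Some k"] by (simp add: d_def)
    have "(\<Sum>x\<in>range ?v. d x *\<^sub>R x) = 0"
    proof -
      have "(\<Sum>x\<in>range ?v. d x *\<^sub>R x) =
          ((\<Sum>k\<in>UNIV. fst p $ k *\<^sub>R partial k r u) + snd p *\<^sub>R r u)
          - ((\<Sum>k\<in>UNIV. fst q $ k *\<^sub>R partial k r u) + snd q *\<^sub>R r u)"
        unfolding sum_frame frame.simps dN dS scaleR_diff_left sum_subtractf
        by (simp only: add_diff_add)
      also have "\<dots> = w - w"
        by (simp only: p[symmetric] q[symmetric])
      finally show ?thesis
        by simp
    qed
    then have z: "d (?v a) = 0" for a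
      by (rule independentD[OF ind finite_imageI[OF finite] subset_refl _ rangeI])
    have "snd p = snd q" "fst p $ k = fst q $ k" for k
      using z[of None] z[of "Some k"] by (simp_all add: dN dS)
    then show ?thesis
      by (simp add: prod_eq_iff vec_eq_iff)
  qed
  show ?thesis
    by (rule ex1I, rule ex, rule uniq[OF _ ex])
qed


section \<open>Equations of associativity\<close>

text \<open>
  Indices running over \<open>0, 1, \<dots>, n\<close> are elements of \<open>'n option\<close>, with \<open>None\<close> as the
  index \<open>0\<close>; the domain of the prepotential is the product of the real line with \<open>U\<close>.
\<close>

definition prepotential ::
    "real^'n::finite^'n \<Rightarrow> (real^'n \<Rightarrow> real) \<Rightarrow> real^('n option) \<Rightarrow> real" where
  "prepotential \<eta> f w =
     1/6 * (w $ None)^3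
     + 1/2 * (\<Sum>i\<in>UNIV. \<Sum>j\<in>UNIV. \<eta> $ i $ j * w $ None * w $ Some i * w $ Some j)
     + f (\<chi> i. w $ Some i)"

definition prepotential_domain :: "(real^'n::finite) set \<Rightarrow> (real^('n option)) set" where
  "prepotential_domain U = {w. (\<chi> i. w $ Some i) \<in> U}"

definition prepotential_metric ::
    "(real^('n::finite option) \<Rightarrow> real) \<Rightarrow> real^('n option) \<Rightarrow> real^('n option)^('n option)" where
  "prepotential_metric F w = (\<chi> a b. partial None (partial a (partial b F)) w)"

definition structure_functions ::
    "(real^('n::finite option) \<Rightarrow> real) \<Rightarrow> 'n option tensor12" where
  "structure_functions F a b c w =
     (\<Sum>d\<in>UNIV. matrix_inv (prepotential_metric F w) $ a $ d
        * partial b (partial c (partial d F)) w)"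

definition algebra_mult ::
    "('a::finite \<Rightarrow> 'a \<Rightarrow> 'a \<Rightarrow> real) \<Rightarrow> real^'a \<Rightarrow> real^'a \<Rightarrow> real^'a" where
  "algebra_mult c x y = (\<chi> a. \<Sum>b\<in>UNIV. \<Sum>d\<in>UNIV. c a b d * x $ b * y $ d)"

definition comm_assoc_structure_constants ::
    "('a::finite \<Rightarrow> 'a \<Rightarrow> 'a \<Rightarrow> real) \<Rightarrow> bool" where
  "comm_assoc_structure_constants c \<longleftrightarrow>
     (\<forall>x y. algebra_mult c x y = algebra_mult c y x) \<and>
     (\<forall>x y z. algebra_mult c (algebra_mult c x y) z = algebra_mult c x (algebra_mult c y z))"

definition associativity_equations ::
    "(real^'n::finite) set \<Rightarrow> real^'n^'n \<Rightarrow> (real^'n \<Rightarrow> real) \<Rightarrow> bool" where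
  "associativity_equations U \<eta> f \<longleftrightarrow>
     (\<forall>w\<in>prepotential_domain U.
        comm_assoc_structure_constants
          (\<lambda>a b c. structure_functions (prepotential \<eta> f) a b c w))"

definition h_from_potential ::
    "(real^'n::finite) set \<Rightarrow> real^'n^'n \<Rightarrow> 'n tensor12 \<Rightarrow> (real^'n \<Rightarrow> real) \<Rightarrow> bool" where
  "h_from_potential U \<eta> h f \<longleftrightarrow>
     (\<forall>u\<in>U. \<forall>s i j.
        h s i j u = (\<Sum>k\<in>UNIV. matrix_inv \<eta> $ s $ k * partial i (partial j (partial k f)) u))"

text \<open>The Gram matrix of the metric \<open>2 dx dy\<close>.\<close>

definition eta_2dxdy :: "real^2^2" where
  "eta_2dxdy = vector [vector [0, 1], vector [1, 0]]"

end

theory Submission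
  imports Defs
begin

text \<open>
  Differentiating \<open>r\<^sub>i\<^sub>j = h\<^sup>s\<^sub>i\<^sub>j r\<^sub>s + \<eta>\<^sub>i\<^sub>j r\<close> once more and commuting derivatives gives the
  Gauss-Codazzi equations. After lowering the index, \<open>h\<close> is symmetric and the Codazzi equations say
  that it is closed, so three applications of the Poincare lemma on \<open>U\<close> yield \<open>f\<close>, provided the
  second antiderivatives are symmetrised in between. The algebra defined by \<open>F\<close> has unit \<open>e\<^sub>0\<close>, so
  its associativity only matters for \<open>(e\<^sub>i e\<^sub>j) e\<^sub>k\<close>; there the \<open>e\<^sub>0\<close>-component holds by the symmetry
  of the third derivatives of \<open>f\<close> and the other components are the Gauss equation.

  The Poincare lemma is proved by integrating locally exact forms along continuous paths: local
  primitives are glued along a homotopy of paths, on the unit square.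
\<close>

section \<open>Smooth functions\<close>

text \<open>The multiplication table e_i e_j = h^s_ij e_s + eta_ij e_0 has the same coefficients as
  the system for r_ij, with e_0 in the place of r and e_s in the place of r_s. The cubic and mixed
  terms of F are chosen to produce this table: they make e_0 the unit and eta_ij the e_0-component
  of e_i e_j, so that the metric terms of the Gauss equation are what this component contributes to
  (e_i e_j) e_k. Two obstacles shape the rest. Each integration fixes its primitive only up to an
  additive constant, and independently chosen constants for the index pairs (i, j) and (j, i) can
  destroy the symmetry that makes the next form closed. And simple connectedness supplies homotopies
  that are merely continuous, so their intermediate paths need not have derivatives to integrate
  against; increments of local primitives take the place of line integrals. A further point concerns
  regularity: h comes from a definite description, and its smoothness has to be recovered from that
  of r by Cramer's rule.\<close>

lemma has_derivative_cong_open: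
  assumes "open S" "x \<in> S" "\<And>y. y \<in> S \<Longrightarrow> f y = g y"
  shows "(f has_derivative D) (at x) \<longleftrightarrow> (g has_derivative D) (at x)"
  using has_derivative_transform_within_open[OF _ assms(1,2)] assms(3) by metis

lemma frechet_derivative_cong_open:
  assumes "open S" "x \<in> S" "\<And>y. y \<in> S \<Longrightarrow> f y = g y"
  shows "frechet_derivative f (at x) = frechet_derivative g (at x)"
  unfolding frechet_derivative_def using has_derivative_cong_open[OF assms] by simp

lemma differentiable_cong_open:
  assumes "open S" "x \<in> S" "\<And>y. y \<in> S \<Longrightarrow> f y = g y"
  shows "f differentiable (at x) \<longleftrightarrow> g differentiable (at x)"
  unfolding differentiable_def using has_derivative_cong_open[OF assms] by simp

text \<open>A derivative depends only on the germ of the function. This is what permits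
  differentiating an identity known only on an open set, as all identities for hypersurfaces
  are.\<close>

lemma partial_cong_open:
  assumes "open S" "x \<in> S" "\<And>y. y \<in> S \<Longrightarrow> f y = g y"
  shows "partial i f x = partial i g x"
  unfolding partial_def using frechet_derivative_cong_open[OF assms] by simp

lemma partial_eqI:
  assumes "(f has_derivative D) (at x)"
  shows "partial i f x = D (axis i 1)"
  unfolding partial_def using frechet_derivative_at[OF assms] by simp

section \<open>Closure properties of C^k and smooth functions\<close>

lemma C_k_on_cong:
  assumes "open S" "\<And>y. y \<in> S \<Longrightarrow> f y = g y"
  shows "C_k_on k S f \<longleftrightarrow> C_k_on k S g"
  using assms(2)
proof (induction k arbitrary: f g)
  case 0
  then show ?case by (simp cong: continuous_on_cong)
next
  case (Suc k)
  show ?case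
    using differentiable_cong_open[OF assms(1) _ Suc.prems]
      Suc.IH[of "\<lambda>x. frechet_derivative f (at x) v" "\<lambda>x. frechet_derivative g (at x) v" for v]
      frechet_derivative_cong_open[OF assms(1) _ Suc.prems]
    by simp
qed

lemma C_k_on_SucD: "C_k_on (Suc k) S f \<Longrightarrow> C_k_on k S f"
proof (induction k arbitrary: f)
  case 0
  then show ?case
    by (auto intro!: continuous_at_imp_continuous_on differentiable_imp_continuous_within)
qed simp

text \<open>Uniqueness of the derivative lets an explicit formula \<open>D\<close> take the place of
  the operator \<open>frechet_derivative\<close> in the recursion for \<open>C_k_on\<close>; all
  closure properties are proved through this rule.\<close>

lemma C_k_on_SucI:
  assumes "open S" "\<And>x. x \<in> S \<Longrightarrow> (f has_derivative D x) (at x)"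
    and "\<And>v. C_k_on k S (\<lambda>x. D x v)"
  shows "C_k_on (Suc k) S f"
proof -
  have "frechet_derivative f (at x) = D x" if "x \<in> S" for x
    using frechet_derivative_at[OF assms(2)[OF that]] by simp
  then have "C_k_on k S (\<lambda>x. frechet_derivative f (at x) v)" for v
    using C_k_on_cong[OF assms(1), of "\<lambda>x. frechet_derivative f (at x) v" "\<lambda>x. D x v" k] assms(3)
    by simp
  then show ?thesis using assms(2) by (auto simp: differentiable_def)
qed

lemma C_k_on_Suc_has_derivative:
  assumes "C_k_on (Suc k) S f" "x \<in> S"
  shows "(f has_derivative frechet_derivative f (at x)) (at x)"
  using assms by (simp add: frechet_derivative_works[symmetric])

lemma C_k_on_const: "C_k_on k S (\<lambda>x. c)"
  by (induction k arbitrary: c) auto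

lemma C_k_on_add:
  assumes "open S" "C_k_on k S f" "C_k_on k S g"
  shows "C_k_on k S (\<lambda>x. f x + g x)"
  using assms(2,3)
proof (induction k arbitrary: f g)
  case (Suc k)
  show ?case
    by (rule C_k_on_SucI[OF assms(1) has_derivative_add, OF
        C_k_on_Suc_has_derivative[OF Suc.prems(1)] C_k_on_Suc_has_derivative[OF Suc.prems(2)]])
      (use Suc in auto)
qed (auto intro: continuous_on_add)

lemma C_k_on_bounded_linear:
  assumes "open S" "bounded_linear L" "C_k_on k S f"
  shows "C_k_on k S (\<lambda>x. L (f x))"
  using assms(3)
proof (induction k arbitrary: f)
  case 0
  then show ?case using bounded_linear.continuous_on[OF assms(2)] by simp
next
  case (Suc k)
  show ?case
    by (rule C_k_on_SucI[OF assms(1) bounded_linear.has_derivative[OF assms(2)], OF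
        C_k_on_Suc_has_derivative[OF Suc.prems(1)]]) (use Suc in auto)
qed

lemma C_k_on_mult:
  fixes f g :: "_ \<Rightarrow> real"
  assumes "open S" "C_k_on k S f" "C_k_on k S g"
  shows "C_k_on k S (\<lambda>x. f x * g x)"
  using assms(2,3)
proof (induction k arbitrary: f g)
  case (Suc k)
  note fg = C_k_on_SucD[OF Suc.prems(1)] C_k_on_SucD[OF Suc.prems(2)]
  show ?case
    by (rule C_k_on_SucI[OF assms(1) has_derivative_mult, OF
        C_k_on_Suc_has_derivative[OF Suc.prems(1)] C_k_on_Suc_has_derivative[OF Suc.prems(2)]])
      (use Suc fg in \<open>auto intro!: C_k_on_add[OF assms(1)]\<close>)
qed (auto intro: continuous_on_mult)

text \<open>The derivative -f'/f^2 is a product of f' and two factors 1/f. Thus the induction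
  hypothesis for 1/f itself, together with closure under products, raises the order by one.\<close>

lemma C_k_on_inverse:
  fixes f :: "_ \<Rightarrow> real"
  assumes "open S" "\<And>x. x \<in> S \<Longrightarrow> f x \<noteq> 0" "C_k_on k S f"
  shows "C_k_on k S (\<lambda>x. inverse (f x))"
  using assms(3)
proof (induction k)
  case 0
  then show ?case using assms(2) by (auto intro: continuous_on_inverse)
next
  case (Suc k)
  have i: "C_k_on k S (\<lambda>x. inverse (f x))"
    using Suc C_k_on_SucD by blast
  have D: "((\<lambda>x. inverse (f x)) has_derivative
      (\<lambda>v. (- 1) * (inverse (f x) * frechet_derivative f (at x) v * inverse (f x)))) (at x)"
    if "x \<in> S" for x
    using Deriv.has_derivative_inverse[OF assms(2)[OF that] C_k_on_Suc_has_derivative[OF Suc.prems that]]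
    by simp
  show ?case
  proof (rule C_k_on_SucI[OF assms(1) D])
    show "C_k_on k S (\<lambda>x. (- 1) * (inverse (f x) * frechet_derivative f (at x) v * inverse (f x)))" for v
      using Suc.prems by (intro C_k_on_mult[OF assms(1)] C_k_on_const i) auto
  qed
qed

lemma smooth_on_cong:
  assumes "open S" "\<And>y. y \<in> S \<Longrightarrow> f y = g y"
  shows "smooth_on S f \<longleftrightarrow> smooth_on S g"
  unfolding smooth_on_def using C_k_on_cong[OF assms] by simp

lemma smooth_on_const: "smooth_on S (\<lambda>x. c)"
  by (simp add: smooth_on_def C_k_on_const)

lemma smooth_on_add:
  "open S \<Longrightarrow> smooth_on S f \<Longrightarrow> smooth_on S g \<Longrightarrow> smooth_on S (\<lambda>x. f x + g x)"
  by (simp add: smooth_on_def C_k_on_add)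

lemma smooth_on_bounded_linear:
  "open S \<Longrightarrow> bounded_linear L \<Longrightarrow> smooth_on S f \<Longrightarrow> smooth_on S (\<lambda>x. L (f x))"
  by (simp add: smooth_on_def C_k_on_bounded_linear)

lemma smooth_on_mult:
  fixes f g :: "_ \<Rightarrow> real"
  shows "open S \<Longrightarrow> smooth_on S f \<Longrightarrow> smooth_on S g \<Longrightarrow> smooth_on S (\<lambda>x. f x * g x)"
  by (simp add: smooth_on_def C_k_on_mult)

lemma smooth_on_inverse:
  fixes f :: "_ \<Rightarrow> real"
  shows "open S \<Longrightarrow> (\<And>x. x \<in> S \<Longrightarrow> f x \<noteq> 0) \<Longrightarrow> smooth_on S f \<Longrightarrow> smooth_on S (\<lambda>x. inverse (f x))"
  by (simp add: smooth_on_def C_k_on_inverse)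

lemma smooth_on_sum:
  assumes "open S" "\<And>i. i \<in> I \<Longrightarrow> smooth_on S (f i)"
  shows "smooth_on S (\<lambda>x. \<Sum>i\<in>I. f i x)"
  using assms(2)
  by (induction I rule: infinite_finite_induct) (auto intro: smooth_on_add[OF assms(1)] smooth_on_const)

lemma smooth_on_prod:
  fixes f :: "_ \<Rightarrow> _ \<Rightarrow> real"
  assumes "open S" "\<And>i. i \<in> I \<Longrightarrow> smooth_on S (f i)"
  shows "smooth_on S (\<lambda>x. \<Prod>i\<in>I. f i x)"
  using assms(2)
  by (induction I rule: infinite_finite_induct) (auto intro: smooth_on_mult[OF assms(1)] smooth_on_const)

lemma smooth_on_has_derivative:
  assumes "smooth_on S f" "x \<in> S"
  shows "(f has_derivative frechet_derivative f (at x)) (at x)"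
  using C_k_on_Suc_has_derivative[of 0] assms unfolding smooth_on_def by blast

lemma smooth_on_frechet_derivative:
  "smooth_on S f \<Longrightarrow> smooth_on S (\<lambda>x. frechet_derivative f (at x) v)"
  unfolding smooth_on_def using C_k_on.simps(2) by blast

lemma smooth_on_partial: "smooth_on S f \<Longrightarrow> smooth_on S (partial i f)"
  unfolding partial_def by (rule smooth_on_frechet_derivative)

lemma smooth_on_imp_continuous_on: "smooth_on S f \<Longrightarrow> continuous_on S f"
  unfolding smooth_on_def using C_k_on.simps(1) by blast

lemma smooth_onI:
  assumes "open S" "\<And>x. x \<in> S \<Longrightarrow> (f has_derivative D x) (at x)"
    and "\<And>v. smooth_on S (\<lambda>x. D x v)"
  shows "smooth_on S f"
proof -
  have "C_k_on (Suc k) S f" for k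
    by (rule C_k_on_SucI[OF assms(1,2)]) (use assms(3) in \<open>auto simp: smooth_on_def\<close>)
  then show ?thesis unfolding smooth_on_def using C_k_on_SucD by blast
qed

text \<open>A determinant is a polynomial in the entries. The result serves Cramer's rule, by which
  the tensor h of a hypersurface is a quotient of two determinants.\<close>

lemma smooth_on_det:
  fixes A :: "_ \<Rightarrow> real^'k::finite^'k"
  assumes "open S" "\<And>a b. smooth_on S (\<lambda>x. A x $ a $ b)"
  shows "smooth_on S (\<lambda>x. det (A x))"
  unfolding det_def
  by (intro smooth_on_sum smooth_on_mult smooth_on_prod smooth_on_const assms)

section \<open>Partial derivatives\<close>

lemma has_derivative_partials:
  fixes f :: "real^'n::finite \<Rightarrow> 'b::real_normed_vector"
  assumes "f differentiable (at x)"
  shows "(f has_derivative (\<lambda>v. \<Sum>i\<in>UNIV. v $ i *\<^sub>R partial i f x)) (at x)"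
proof -
  have d: "(f has_derivative frechet_derivative f (at x)) (at x)"
    using assms frechet_derivative_works by blast
  interpret linear "frechet_derivative f (at x)"
    using assms by (rule linear_frechet_derivative)
  have "frechet_derivative f (at x) v = (\<Sum>i\<in>UNIV. v $ i *\<^sub>R partial i f x)" for v
  proof -
    have "frechet_derivative f (at x) v = frechet_derivative f (at x) (\<Sum>i\<in>UNIV. v $ i *\<^sub>R axis i 1)"
      by (simp add: basis_expansion[of v, unfolded scalar_mult_eq_scaleR])
    then show ?thesis by (simp add: sum scale partial_def)
  qed
  then show ?thesis using d by presburger
qed

lemma smooth_on_differentiable: "smooth_on S f \<Longrightarrow> x \<in> S \<Longrightarrow> f differentiable (at x)"
  using smooth_on_has_derivative differentiable_def by blast

lemma smooth_on_partialsI: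
  fixes f :: "real^'n::finite \<Rightarrow> real"
  assumes "open S" "\<And>x. x \<in> S \<Longrightarrow> (f has_derivative (\<lambda>v. \<Sum>i\<in>UNIV. p i x * v $ i)) (at x)"
    and "\<And>i. smooth_on S (p i)"
  shows "smooth_on S f"
proof (rule smooth_onI[OF assms(1,2)])
  show "smooth_on S (\<lambda>x. \<Sum>i\<in>UNIV. p i x * v $ i)" for v
    by (intro smooth_on_sum smooth_on_mult smooth_on_const assms)
qed

lemma partial_component:
  fixes r :: "real^'n::finite \<Rightarrow> real^'m::finite"
  assumes "r differentiable (at x)"
  shows "partial i (\<lambda>v. r v $ k) x = partial i r x $ k"
proof -
  have "((\<lambda>v. r v $ k) has_derivative (\<lambda>v. frechet_derivative r (at x) v $ k)) (at x)"
    using assms frechet_derivative_works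
    by (blast intro: bounded_linear.has_derivative[OF bounded_linear_vec_nth])
  from partial_eqI[OF this] show ?thesis by (simp add: partial_def)
qed

lemma smooth_on_component:
  fixes r :: "real^'n::finite \<Rightarrow> real^'m::finite"
  shows "open S \<Longrightarrow> smooth_on S r \<Longrightarrow> smooth_on S (\<lambda>v. r v $ k)"
  by (rule smooth_on_bounded_linear[OF _ bounded_linear_vec_nth])

section \<open>Symmetry of second derivatives\<close>

lemma has_real_derivative_along_line:
  assumes "(f has_derivative D) (at (x + s *\<^sub>R v))"
  shows "((\<lambda>t. f (x + t *\<^sub>R v) :: real) has_real_derivative D v) (at s)"
proof -
  have "((\<lambda>t. x + t *\<^sub>R v) has_derivative (\<lambda>h. h *\<^sub>R v)) (at s)"
    by (auto intro!: derivative_eq_intros)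
  from has_derivative_compose[OF this assms]
  have "((\<lambda>t. f (x + t *\<^sub>R v)) has_derivative (\<lambda>h. D (h *\<^sub>R v))) (at s)" .
  moreover have "D (h *\<^sub>R v) = D v * h" for h
    using linear_scale[OF has_derivative_linear[OF assms]] by simp
  ultimately show ?thesis by (simp add: has_field_derivative_def)
qed

text \<open>Two applications of the mean value theorem to the second difference of \<open>f\<close> over the
  parallelogram spanned by small multiples of \<open>v\<close> and \<open>w\<close>.\<close>

lemma second_difference_mean_value:
  fixes f :: "'a::real_normed_vector \<Rightarrow> real"
  assumes e: "e > 0"
    and f1: "\<And>y. y \<in> ball x (e * (norm v + norm w + 1)) \<Longrightarrow> (f has_derivative f' y) (at y)"
    and f2: "\<And>y. y \<in> ball x (e * (norm v + norm w + 1)) \<Longrightarrow>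
        ((\<lambda>z. f' z v) has_derivative f'' y) (at y)"
  obtains y where "y \<in> ball x (e * (norm v + norm w + 1))"
    and "f (x + (e/2) *\<^sub>R v + (e/2) *\<^sub>R w) - f (x + (e/2) *\<^sub>R v) - f (x + (e/2) *\<^sub>R w) + f x
         = (e/2)\<^sup>2 * f'' y w"
proof -
  let ?B = "ball x (e * (norm v + norm w + 1))"
  \<comment> \<open>The summand 1 in the radius keeps the ball nonempty when v = w = 0 and makes the
    estimate strict.\<close>
  have inB: "x + s *\<^sub>R v + t *\<^sub>R w \<in> ?B" if "0 \<le> s" "s \<le> e/2" "0 \<le> t" "t \<le> e/2" for s t
  proof -
    have "norm (s *\<^sub>R v + t *\<^sub>R w) \<le> s * norm v + t * norm w"
      using that norm_triangle_ineq[of "s *\<^sub>R v" "t *\<^sub>R w"] by simp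
    also have "\<dots> \<le> e * norm v + e * norm w"
      using that e by (intro add_mono mult_right_mono) auto
    also have "\<dots> < e * (norm v + norm w + 1)" using e by (simp add: algebra_simps)
    finally show ?thesis by (simp add: dist_norm norm_minus_commute add.assoc
          norm_minus_cancel[of "s *\<^sub>R v + t *\<^sub>R w", symmetric] del: norm_minus_cancel)
  qed
  \<comment> \<open>The second difference is the increment over [0, e/2] of the function sending s
    to f(x + (e/2)w + s v) - f(x + s v). After s is found, the same theorem is applied in the
    direction w.\<close>
  have "\<exists>s. 0 < s \<and> s < e/2 \<and>
      (f (x + (e/2) *\<^sub>R w + (e/2) *\<^sub>R v) - f (x + (e/2) *\<^sub>R v)) - (f (x + (e/2) *\<^sub>R w + 0 *\<^sub>R v) - f (x + 0 *\<^sub>R v))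
      = (e/2 - 0) * (f' (x + (e/2) *\<^sub>R w + s *\<^sub>R v) v - f' (x + s *\<^sub>R v) v)"
  proof (rule MVT2)
    fix s assume s: "0 \<le> s" "s \<le> e/2"
    have "x + (e/2) *\<^sub>R w + s *\<^sub>R v \<in> ?B" "x + s *\<^sub>R v \<in> ?B"
      using inB[of s "e/2"] inB[of s 0] s e by (simp_all add: algebra_simps)
    then show "((\<lambda>s. f (x + (e/2) *\<^sub>R w + s *\<^sub>R v) - f (x + s *\<^sub>R v)) has_real_derivative
        f' (x + (e/2) *\<^sub>R w + s *\<^sub>R v) v - f' (x + s *\<^sub>R v) v) (at s)"
      by (intro DERIV_diff has_real_derivative_along_line f1)
  qed (use e in simp)
  then obtain s where s: "0 < s" "s < e/2"
    "f (x + (e/2) *\<^sub>R w + (e/2) *\<^sub>R v) - f (x + (e/2) *\<^sub>R v) - (f (x + (e/2) *\<^sub>R w + 0 *\<^sub>R v) - f (x + 0 *\<^sub>R v))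
      = (e/2 - 0) * (f' (x + (e/2) *\<^sub>R w + s *\<^sub>R v) v - f' (x + s *\<^sub>R v) v)" by blast
  have "\<exists>t. 0 < t \<and> t < e/2 \<and>
      f' (x + s *\<^sub>R v + (e/2) *\<^sub>R w) v - f' (x + s *\<^sub>R v + 0 *\<^sub>R w) v = (e/2 - 0) * f'' (x + s *\<^sub>R v + t *\<^sub>R w) w"
    using s e by (intro MVT2 has_real_derivative_along_line[where f = "\<lambda>z. f' z v"] f2 inB) auto
  then obtain t where t: "0 < t" "t < e/2"
    "f' (x + s *\<^sub>R v + (e/2) *\<^sub>R w) v - f' (x + s *\<^sub>R v + 0 *\<^sub>R w) v = (e/2 - 0) * f'' (x + s *\<^sub>R v + t *\<^sub>R w) w"
    by blast
  show thesis
  proof (rule that)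
    show "x + s *\<^sub>R v + t *\<^sub>R w \<in> ?B" using s t by (intro inB) auto
    show "f (x + (e/2) *\<^sub>R v + (e/2) *\<^sub>R w) - f (x + (e/2) *\<^sub>R v) - f (x + (e/2) *\<^sub>R w) + f x
         = (e/2)\<^sup>2 * f'' (x + s *\<^sub>R v + t *\<^sub>R w) w"
    proof -
      have "f (x + (e/2) *\<^sub>R v + (e/2) *\<^sub>R w) - f (x + (e/2) *\<^sub>R v) - f (x + (e/2) *\<^sub>R w) + f x
          = (e/2) * (f' (x + s *\<^sub>R v + (e/2) *\<^sub>R w) v - f' (x + s *\<^sub>R v) v)"
        using s(3) unfolding add.assoc add.commute[of "_ *\<^sub>R v" "_ *\<^sub>R w"] scaleR_zero_left
        by (simp only: diff_diff_eq2 diff_zero add.right_neutral)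
      moreover have "f' (x + s *\<^sub>R v + (e/2) *\<^sub>R w) v - f' (x + s *\<^sub>R v) v = (e/2) * f'' (x + s *\<^sub>R v + t *\<^sub>R w) w"
        using t(3) by (simp only: scaleR_zero_left add.right_neutral diff_zero)
      ultimately show ?thesis
        by (simp only: power2_eq_square mult.assoc)
    qed
  qed
qed

lemma eventually_nhds_dist_less:
  fixes g :: "'a::t2_space \<Rightarrow> 'b::metric_space"
  assumes "open S" "x \<in> S" "continuous_on S g" "d > 0"
  shows "\<forall>\<^sub>F y in nhds x. dist (g y) (g x) < d"
proof -
  have "isCont g x"
    using assms(1-3) continuous_on_eq_continuous_at by blast
  then have "(g \<longlongrightarrow> g x) (nhds x)"
    by (simp add: continuous_at tendsto_at_iff_tendsto_nhds)
  then show ?thesis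
    using assms(4) by (rule tendstoD)
qed

text \<open>The second difference does not change when v and w are exchanged. Hence the two mixed
  derivatives take a common value at two, possibly different, points arbitrarily close to x, and
  continuity carries the equality to x.\<close>

lemma second_derivative_symmetric:
  fixes f :: "'a::real_normed_vector \<Rightarrow> real"
  assumes S: "open S" "x \<in> S"
    and f: "\<And>y. y \<in> S \<Longrightarrow> (f has_derivative f' y) (at y)"
    and fv: "\<And>y. y \<in> S \<Longrightarrow> ((\<lambda>z. f' z v) has_derivative fv y) (at y)"
    and fw: "\<And>y. y \<in> S \<Longrightarrow> ((\<lambda>z. f' z w) has_derivative fw y) (at y)"
    and cv: "continuous_on S (\<lambda>y. fv y w)" and cw: "continuous_on S (\<lambda>y. fw y v)"
  shows "fv x w = fw x v"
proof (rule ccontr)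
  assume neq: "fv x w \<noteq> fw x v"
  \<comment> \<open>Half of the supposed gap: numbers closer than d to \<open>fv x w\<close> and to
    \<open>fw x v\<close> respectively cannot be equal.\<close>
  define d where "d = dist (fv x w) (fw x v) / 2"
  have d: "d > 0" using neq by (simp add: d_def)
  have "\<forall>\<^sub>F y in nhds x. y \<in> S" using S eventually_nhds by blast
  moreover have "\<forall>\<^sub>F y in nhds x. dist (fv y w) (fv x w) < d"
    by (rule eventually_nhds_dist_less[OF S cv d])
  moreover have "\<forall>\<^sub>F y in nhds x. dist (fw y v) (fw x v) < d"
    by (rule eventually_nhds_dist_less[OF S cw d])
  ultimately have "\<forall>\<^sub>F y in nhds x. y \<in> S \<and> dist (fv y w) (fv x w) < d \<and> dist (fw y v) (fw x v) < d"
    by (intro eventually_conj)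
  then obtain r where "r > 0" "\<forall>y. dist y x < r \<longrightarrow>
      y \<in> S \<and> dist (fv y w) (fv x w) < d \<and> dist (fw y v) (fw x v) < d"
    unfolding eventually_nhds_metric by blast
  then have r: "r > 0" "\<And>y. y \<in> ball x r \<Longrightarrow>
      y \<in> S \<and> dist (fv y w) (fv x w) < d \<and> dist (fw y v) (fw x v) < d"
    by (simp_all add: dist_commute)
  \<comment> \<open>Chosen so that the ball in the mean value argument is exactly
    \<open>ball x r\<close>.\<close>
  define e where "e = r / (norm v + norm w + 1)"
  have nz: "norm v + norm w + 1 > 0" by (simp add: add_nonneg_pos)
  have e: "e > 0" "e * (norm v + norm w + 1) = r" "e * (norm w + norm v + 1) = r"
    using r(1) nz by (simp_all add: e_def add.commute)
  obtain y where y: "y \<in> ball x r"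
    "f (x + (e/2) *\<^sub>R v + (e/2) *\<^sub>R w) - f (x + (e/2) *\<^sub>R v) - f (x + (e/2) *\<^sub>R w) + f x = (e/2)\<^sup>2 * fv y w"
  proof (rule second_difference_mean_value[OF e(1), of x v w f f' fv, unfolded e(2)])
  qed (use f fv r(2) in auto)
  obtain z where z: "z \<in> ball x r"
    "f (x + (e/2) *\<^sub>R w + (e/2) *\<^sub>R v) - f (x + (e/2) *\<^sub>R w) - f (x + (e/2) *\<^sub>R v) + f x = (e/2)\<^sup>2 * fw z v"
  proof (rule second_difference_mean_value[OF e(1), of x w v f f' fw, unfolded e(3)])
  qed (use f fw r(2) in auto)
  have "(e/2)\<^sup>2 * fv y w = (e/2)\<^sup>2 * fw z v"
    using y(2) z(2) by (simp add: algebra_simps)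
  then have "fv y w = fw z v" using e by simp
  then have "dist (fv x w) (fw x v) < d + d"
    using r(2)[OF y(1)] r(2)[OF z(1)] by (metis dist_commute dist_triangle_less_add)
  then show False by (simp add: d_def)
qed

lemma partial_commute_real:
  fixes f :: "real^'n::finite \<Rightarrow> real"
  assumes "open S" "smooth_on S f" "x \<in> S"
  shows "partial i (partial j f) x = partial j (partial i f) x"
proof -
  have d: "((\<lambda>z. frechet_derivative f (at z) v) has_derivative
      frechet_derivative (\<lambda>z. frechet_derivative f (at z) v) (at y)) (at y)" if "y \<in> S" for y v
    by (rule smooth_on_has_derivative[OF smooth_on_frechet_derivative[OF assms(2)] that])
  have c: "continuous_on S (\<lambda>y. frechet_derivative (\<lambda>z. frechet_derivative f (at z) v) (at y) w)" for v w
    by (intro smooth_on_imp_continuous_on smooth_on_frechet_derivative assms)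
  show ?thesis
    unfolding partial_def
    by (rule second_derivative_symmetric[OF assms(1,3) smooth_on_has_derivative[OF assms(2)]
          d d c c])
qed

text \<open>The mean value theorem needs real values, so the vector-valued case is reduced to
  components.\<close>

lemma partial_commute:
  fixes r :: "real^'n::finite \<Rightarrow> real^'m::finite"
  assumes "open S" "smooth_on S r" "x \<in> S"
  shows "partial i (partial j r) x = partial j (partial i r) x"
proof -
  have "partial i (partial j r) x $ k = partial j (partial i r) x $ k" for k
  proof -
    have *: "partial a (partial b r) x $ k = partial a (partial b (\<lambda>v. r v $ k)) x" for a b
    proof -
      have "partial a (partial b r) x $ k = partial a (\<lambda>v. partial b r v $ k) x"
        by (rule partial_component[symmetric])
          (rule smooth_on_differentiable[OF smooth_on_partial[OF assms(2)] assms(3)])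
      also have "\<dots> = partial a (partial b (\<lambda>v. r v $ k)) x"
        by (rule partial_cong_open[OF assms(1,3)])
          (simp add: partial_component smooth_on_differentiable[OF assms(2)])
      finally show ?thesis .
    qed
    show ?thesis
      unfolding * by (rule partial_commute_real[OF assms(1) smooth_on_component[OF assms(1,2)] assms(3)])
  qed
  then show ?thesis by (simp add: vec_eq_iff)
qed

section \<open>The Poincare lemma\<close>

text \<open>The form is represented by a vector field w through the inner product, and closedness is
  symmetry of its derivative. P(x) is the integral of the form along the segment from a to x.
  Symmetry identifies the x-gradient of the integrand with the t-derivative of t w(a + t(x - a)),
  whose integral over [0, 1] is w(x).\<close>

lemma star_primitive:
  fixes w :: "'a::euclidean_space \<Rightarrow> 'a"
  assumes B: "open B" "convex B"
    and w: "\<And>x. x \<in> B \<Longrightarrow> (w has_derivative w' x) (at x)"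
    and sym: "\<And>x u v. x \<in> B \<Longrightarrow> w' x u \<bullet> v = w' x v \<bullet> u"
    and cont: "\<And>v. continuous_on B (\<lambda>x. w' x v)"
  obtains P where "\<And>x. x \<in> B \<Longrightarrow> (P has_derivative (\<lambda>v. w x \<bullet> v)) (at x)"
proof (cases "B = {}")
  case False
  then obtain a where a: "a \<in> B" by blast
  have inB: "a + t *\<^sub>R (x - a) \<in> B" if "x \<in> B" "t \<in> {0..1}" for x t
  proof -
    have "(1 - t) *\<^sub>R a + t *\<^sub>R x \<in> B" using B(2) a that by (auto simp: convex_alt)
    then show ?thesis by (simp add: algebra_simps)
  qed
  \<comment> \<open>The t-derivative of t w(a + t(x - a)).\<close>
  define g where "g x t = w (a + t *\<^sub>R (x - a)) + t *\<^sub>R w' (a + t *\<^sub>R (x - a)) (x - a)" for x t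
  have int_g: "(g x has_integral w x) {0..1}" if "x \<in> B" for x
  proof -
    have "((\<lambda>t. t *\<^sub>R w (a + t *\<^sub>R (x - a))) has_vector_derivative g x t) (at t within {0..1})"
      if t: "t \<in> {0..1}" for t
    proof -
      have z: "a + t *\<^sub>R (x - a) \<in> B" using inB \<open>x \<in> B\<close> t by blast
      have "((\<lambda>t. a + t *\<^sub>R (x - a)) has_derivative (\<lambda>h. h *\<^sub>R (x - a))) (at t)"
        by (auto intro!: derivative_eq_intros)
      from has_derivative_compose[OF this w[OF z]]
      have "((\<lambda>t. w (a + t *\<^sub>R (x - a))) has_derivative (\<lambda>h. w' (a + t *\<^sub>R (x - a)) (h *\<^sub>R (x - a)))) (at t)" .
      then have "((\<lambda>t. w (a + t *\<^sub>R (x - a))) has_vector_derivative w' (a + t *\<^sub>R (x - a)) (x - a)) (at t)"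
        by (simp add: has_vector_derivative_def linear_scale[OF has_derivative_linear[OF w[OF z]]])
      from has_vector_derivative_scaleR[OF DERIV_ident this]
      show ?thesis unfolding g_def by (rule has_vector_derivative_at_within[OF has_vector_derivative_eq_rhs]) simp
    qed
    from fundamental_theorem_of_calculus[OF _ this] show ?thesis by simp
  qed
  have cont_w: "continuous_on B w"
    by (rule continuous_at_imp_continuous_on) (use w has_derivative_continuous in blast)
  have cont_path: "continuous_on (B \<times> {0..1}) (\<lambda>(x, t). F (a + t *\<^sub>R (x - a)))" if "continuous_on B F" for F :: "'a \<Rightarrow> 'a"
  proof -
    have "continuous_on (B \<times> {0..1}) (\<lambda>y. a + snd y *\<^sub>R (fst y - a))"
      by (intro continuous_intros)
    moreover have "(\<lambda>y. a + snd y *\<^sub>R (fst y - a)) ` (B \<times> {0..1}) \<subseteq> B"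
      using inB by auto
    ultimately show ?thesis
      unfolding case_prod_unfold by (rule continuous_on_compose2[OF that])
  qed
  \<comment> \<open>Continuity of w' is given for each fixed direction only, while \<open>g\<close>
    evaluates it in the moving direction x - a. Expanding in the basis reduces to fixed
    directions.\<close>
  have w'_expand: "w' z v = (\<Sum>b\<in>Basis. (v \<bullet> b) *\<^sub>R w' z b)" if "z \<in> B" for z v
  proof -
    have "w' z v = w' z (\<Sum>b\<in>Basis. (v \<bullet> b) *\<^sub>R b)" by (simp add: euclidean_representation)
    then show ?thesis
      using has_derivative_linear[OF w[OF that]] by (simp add: linear_sum linear_scale)
  qed
  have "continuous_on (B \<times> {0..1}) (\<lambda>y. (\<lambda>(x, t). w (a + t *\<^sub>R (x - a))) y
      + snd y *\<^sub>R (\<Sum>b\<in>Basis. ((fst y - a) \<bullet> b) *\<^sub>R (\<lambda>(x, t). w' (a + t *\<^sub>R (x - a)) b) y))"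
    by (intro continuous_intros cont_path cont cont_w)
  then have cont_g: "continuous_on (B \<times> {0..1}) (\<lambda>(x, t). g x t)"
    by (rule continuous_on_eq) (use inB in \<open>auto simp: g_def w'_expand[symmetric]\<close>)
  define P where "P x = integral (cbox 0 1) (\<lambda>t. w (a + t *\<^sub>R (x - a)) \<bullet> (x - a))" for x
  have "(P has_derivative (\<lambda>v. w x0 \<bullet> v)) (at x0)" if x0: "x0 \<in> B" for x0
  proof -
    have "(P has_derivative integral (cbox 0 1) (\<lambda>t. blinfun_inner_right (g x0 t))) (at x0 within B)"
      unfolding P_def
    proof (rule leibniz_rule[OF _ _ _ x0 B(2)])
      fix x t :: _ assume x: "x \<in> B" and t: "t \<in> cbox (0::real) 1"
      have z: "a + t *\<^sub>R (x - a) \<in> B" using inB x t by simp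
      have "((\<lambda>x. a + t *\<^sub>R (x - a)) has_derivative (\<lambda>h. t *\<^sub>R h)) (at x)"
        by (auto intro!: derivative_eq_intros)
      from has_derivative_compose[OF this w[OF z]]
      have 1: "((\<lambda>x. w (a + t *\<^sub>R (x - a))) has_derivative (\<lambda>h. w' (a + t *\<^sub>R (x - a)) (t *\<^sub>R h))) (at x)" .
      have 2: "((\<lambda>x. x - a) has_derivative (\<lambda>h. h)) (at x)"
        by (auto intro!: derivative_eq_intros)
      \<comment> \<open>Closedness enters here: it exchanges h and x - a, which turns the derivative
        of the integrand in the direction h into \<open>g x t\<close> paired with h.\<close>
      have 3: "w' (a + t *\<^sub>R (x - a)) (t *\<^sub>R h) \<bullet> (x - a) = t * (w' (a + t *\<^sub>R (x - a)) (x - a) \<bullet> h)" for h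
        using sym[OF z, of h "x - a"] linear_scale[OF has_derivative_linear[OF w[OF z]]] by simp
      show "((\<lambda>x. w (a + t *\<^sub>R (x - a)) \<bullet> (x - a)) has_derivative blinfun_apply (blinfun_inner_right (g x t)))
          (at x within B)"
        by (rule has_derivative_at_withinI, rule has_derivative_eq_rhs[OF has_derivative_inner[OF 1 2]])
          (simp add: 3 g_def inner_add_left fun_eq_iff)
    next
      fix x assume x: "x \<in> B"
      have "continuous_on {0..1} (\<lambda>t. w (a + t *\<^sub>R (x - a)))"
        using inB x by (intro continuous_on_compose2[OF cont_w] continuous_intros) auto
      then show "(\<lambda>t. w (a + t *\<^sub>R (x - a)) \<bullet> (x - a)) integrable_on cbox 0 1"
        by (intro integrable_continuous continuous_intros) auto
    next
      show "continuous_on (B \<times> cbox 0 1) (\<lambda>(x, t). blinfun_inner_right (g x t))"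
        using bounded_linear.continuous_on[OF bounded_linear_blinfun_inner_right cont_g]
        by (simp add: case_prod_unfold)
    qed
    moreover have "integral (cbox 0 1) (\<lambda>t. blinfun_inner_right (g x0 t)) = blinfun_inner_right (w x0)"
      using has_integral_linear[OF int_g[OF x0] bounded_linear_blinfun_inner_right]
      by (auto simp: o_def intro!: integral_unique)
    ultimately show ?thesis
      using at_within_open[OF x0 B(1)] by (simp add: fun_eq_iff)
  qed
  then show thesis using that by blast
qed (use that in blast)

section \<open>Local primitives carried along continuous maps\<close>

definition primitive_near :: "('a::real_normed_vector \<Rightarrow> 'a \<Rightarrow> real) \<Rightarrow> 'a \<Rightarrow> ('a \<Rightarrow> real) \<Rightarrow> bool" where
  "primitive_near \<omega> x P \<longleftrightarrow> (\<forall>\<^sub>F y in nhds x. (P has_derivative \<omega> y) (at y))"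

text \<open>\<open>\<Phi>\<close> is locally \<open>P \<circ> H\<close> for primitives \<open>P\<close> of \<open>\<omega>\<close>; along a path its increment is
  the integral of \<open>\<omega>\<close>, although the path is only continuous.\<close>

definition primitive_along ::
  "('a::real_normed_vector \<Rightarrow> 'a \<Rightarrow> real) \<Rightarrow> 'b::topological_space set \<Rightarrow> ('b \<Rightarrow> 'a) \<Rightarrow> ('b \<Rightarrow> real) \<Rightarrow> bool" where
  "primitive_along \<omega> A H \<Phi> \<longleftrightarrow>
     (\<forall>t\<in>A. \<exists>P. primitive_near \<omega> (H t) P \<and> (\<forall>\<^sub>F s in nhds t. s \<in> A \<longrightarrow> \<Phi> s = P (H s)))"

lemma eventually_nhds_continuous_on:
  assumes "continuous_on A g" "t \<in> A" "\<forall>\<^sub>F y in nhds (g t). Q y"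
  shows "\<forall>\<^sub>F s in nhds t. s \<in> A \<longrightarrow> Q (g s)"
proof -
  obtain S where "open S" "g t \<in> S" "\<And>y. y \<in> S \<Longrightarrow> Q y"
    using assms(3) by (auto simp: eventually_nhds)
  with assms(1,2) show ?thesis
    unfolding continuous_on_topological eventually_nhds by meson
qed

lemma primitive_near_unique:
  assumes "primitive_near \<omega> x P" "primitive_near \<omega> x Q"
  shows "\<forall>\<^sub>F y in nhds x. P y - Q y = P x - Q x"
proof -
  have "\<forall>\<^sub>F y in nhds x. (P has_derivative \<omega> y) (at y) \<and> (Q has_derivative \<omega> y) (at y)"
    using assms by (simp add: primitive_near_def eventually_conj)
  then obtain r where r: "r > 0" and
    d: "\<And>y. dist y x < r \<Longrightarrow> (P has_derivative \<omega> y) (at y) \<and> (Q has_derivative \<omega> y) (at y)"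
    unfolding eventually_nhds_metric by blast
  have "P y - Q y = P x - Q x" if "y \<in> ball x r" for y
  proof (rule has_derivative_zero_unique[of "ball x r" "\<lambda>y. P y - Q y"])
    fix z assume "z \<in> ball x r"
    then have "(P has_derivative \<omega> z) (at z)" "(Q has_derivative \<omega> z) (at z)"
      using d[of z] by (simp_all add: dist_commute)
    from has_derivative_diff[OF this] show "((\<lambda>y. P y - Q y) has_derivative (\<lambda>v. 0)) (at z within ball x r)"
      by (simp add: has_derivative_at_withinI)
  qed (use that r in auto)
  then have "\<forall>y. dist y x < r \<longrightarrow> P y - Q y = P x - Q x"
    by (metis mem_ball dist_commute)
  then show ?thesis
    unfolding eventually_nhds_metric using r by blast
qed

lemma primitive_near_add_const:
  "primitive_near \<omega> x P \<Longrightarrow> primitive_near \<omega> x (\<lambda>y. P y + c)"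
  unfolding primitive_near_def
  by (erule eventually_mono) (auto intro!: derivative_eq_intros)

lemma primitive_along_add_const:
  assumes "primitive_along \<omega> A H \<Phi>"
  shows "primitive_along \<omega> A H (\<lambda>s. \<Phi> s + c)"
  unfolding primitive_along_def
proof
  fix t assume "t \<in> A"
  then obtain P where P: "primitive_near \<omega> (H t) P" "\<forall>\<^sub>F s in nhds t. s \<in> A \<longrightarrow> \<Phi> s = P (H s)"
    using assms by (auto simp: primitive_along_def)
  then show "\<exists>P. primitive_near \<omega> (H t) P \<and> (\<forall>\<^sub>F s in nhds t. s \<in> A \<longrightarrow> \<Phi> s + c = P (H s))"
    by (intro exI[of _ "\<lambda>y. P y + c"] conjI primitive_near_add_const) (auto elim: eventually_mono)
qed

lemma primitive_along_compose:
  assumes "primitive_along \<omega> A H \<Phi>" "continuous_on C g" "g ` C \<subseteq> A"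
  shows "primitive_along \<omega> C (\<lambda>s. H (g s)) (\<lambda>s. \<Phi> (g s))"
  unfolding primitive_along_def
proof
  fix t assume t: "t \<in> C"
  then obtain P where P: "primitive_near \<omega> (H (g t)) P"
    "\<forall>\<^sub>F s in nhds (g t). s \<in> A \<longrightarrow> \<Phi> s = P (H s)"
    using assms by (auto simp: primitive_along_def)
  have "\<forall>\<^sub>F s in nhds t. s \<in> C \<longrightarrow> \<Phi> (g s) = P (H (g s))"
    using eventually_nhds_continuous_on[OF assms(2) t P(2)]
    by (rule eventually_mono) (use assms(3) in blast)
  with P(1) show "\<exists>P. primitive_near \<omega> (H (g t)) P \<and> (\<forall>\<^sub>F s in nhds t. s \<in> C \<longrightarrow> \<Phi> (g s) = P (H (g s)))"
    by blast
qed

lemma primitive_along_subset: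
  "primitive_along \<omega> A H \<Phi> \<Longrightarrow> C \<subseteq> A \<Longrightarrow> primitive_along \<omega> C H \<Phi>"
  using primitive_along_compose[of \<omega> A H \<Phi> C "\<lambda>x. x"] by (simp add: continuous_on_id)

lemma primitive_along_cong:
  assumes "primitive_along \<omega> A H \<Phi>" "\<And>s. s \<in> A \<Longrightarrow> H s = H' s" "\<And>s. s \<in> A \<Longrightarrow> \<Phi> s = \<Phi>' s"
  shows "primitive_along \<omega> A H' \<Phi>'"
  using assms unfolding primitive_along_def by simp

text \<open>Near \<open>H a\<close> two local primitives differ by a constant, so the difference of
  \<open>\<Phi>\<close> and \<open>\<Psi>\<close> is locally constant on the connected set A. For a
  path this says that the increment does not depend on the choice of \<open>\<Phi>\<close>, which
  makes it a well-defined integral.\<close>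

lemma primitive_along_diff_const:
  assumes "connected A" "continuous_on A H"
    and "primitive_along \<omega> A H \<Phi>" "primitive_along \<omega> A H \<Psi>" "s \<in> A" "t \<in> A"
  shows "\<Phi> s - \<Psi> s = \<Phi> t - \<Psi> t"
proof -
  have "(\<lambda>s. \<Phi> s - \<Psi> s) constant_on A"
  proof (rule locally_constant_imp_constant[OF assms(1)])
    fix a assume a: "a \<in> A"
    obtain P where P: "primitive_near \<omega> (H a) P" "\<forall>\<^sub>F s in nhds a. s \<in> A \<longrightarrow> \<Phi> s = P (H s)"
      using assms(3) a by (auto simp: primitive_along_def)
    obtain Q where Q: "primitive_near \<omega> (H a) Q" "\<forall>\<^sub>F s in nhds a. s \<in> A \<longrightarrow> \<Psi> s = Q (H s)"
      using assms(4) a by (auto simp: primitive_along_def)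
    have a_eq: "\<Phi> a = P (H a)" "\<Psi> a = Q (H a)"
      using eventually_nhds_x_imp_x[OF P(2)] eventually_nhds_x_imp_x[OF Q(2)] a by auto
    have "\<forall>\<^sub>F s in nhds a. s \<in> A \<longrightarrow> P (H s) - Q (H s) = P (H a) - Q (H a)"
      by (rule eventually_nhds_continuous_on[OF assms(2) a primitive_near_unique[OF P(1) Q(1)]])
    with P(2) Q(2) have "\<forall>\<^sub>F s in nhds a. s \<in> A \<longrightarrow> \<Phi> s - \<Psi> s = \<Phi> a - \<Psi> a"
      by eventually_elim (auto simp: a_eq)
    then obtain T where "open T" "a \<in> T" "\<forall>s\<in>T. s \<in> A \<longrightarrow> \<Phi> s - \<Psi> s = \<Phi> a - \<Psi> a"
      unfolding eventually_nhds by blast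
    then show "\<exists>T. openin (top_of_set A) T \<and> a \<in> T \<and> (\<forall>x\<in>T. \<Phi> x - \<Psi> x = \<Phi> a - \<Psi> a)"
      using a by (intro exI[of _ "A \<inter> T"] conjI openin_open_Int) blast+
  qed
  then show ?thesis using assms(5,6) by (auto simp: constant_on_def)
qed

text \<open>On the connected overlap the two functions differ by a single constant, and shifting one
  of them by it makes them agree. A disconnected overlap could require several different
  constants.\<close>

lemma primitive_along_glue:
  fixes A B :: "'b::topological_space set"
  assumes "closed A" "closed B" "connected (A \<inter> B)" "A \<inter> B \<noteq> {}" "continuous_on (A \<union> B) H"
    and \<Phi>: "primitive_along \<omega> A H \<Phi>" and \<Psi>: "primitive_along \<omega> B H \<Psi>"
  obtains \<Theta> where "primitive_along \<omega> (A \<union> B) H \<Theta>"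
proof -
  obtain t0 where t0: "t0 \<in> A \<inter> B" using assms(4) by blast
  define \<Psi>' where "\<Psi>' s = \<Psi> s + (\<Phi> t0 - \<Psi> t0)" for s
  have \<Psi>': "primitive_along \<omega> B H \<Psi>'"
    unfolding \<Psi>'_def by (rule primitive_along_add_const[OF \<Psi>])
  have agree: "\<Phi> s = \<Psi>' s" if "s \<in> A \<inter> B" for s
  proof -
    have "\<Phi> s - \<Psi> s = \<Phi> t0 - \<Psi> t0"
      by (rule primitive_along_diff_const[OF assms(3) continuous_on_subset[OF assms(5)]
            primitive_along_subset[OF \<Phi>] primitive_along_subset[OF \<Psi>] that t0]) auto
    then show ?thesis by (simp add: \<Psi>'_def)
  qed
  define \<Theta> where "\<Theta> s = (if s \<in> A then \<Phi> s else \<Psi>' s)" for s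
  have \<Theta>A: "s \<in> A \<Longrightarrow> \<Theta> s = \<Phi> s" and \<Theta>B: "s \<in> B \<Longrightarrow> \<Theta> s = \<Psi>' s" for s
    using agree by (auto simp: \<Theta>_def)
  \<comment> \<open>Closedness of the pieces: near a point outside one piece only the other piece
    has to be considered.\<close>
  have off: "\<forall>\<^sub>F s in nhds t. s \<notin> C" if "closed C" "t \<notin> C" for t C
    using that by (auto simp: eventually_nhds intro!: exI[of _ "- C"])
  have "\<exists>P. primitive_near \<omega> (H t) P \<and> (\<forall>\<^sub>F s in nhds t. s \<in> A \<union> B \<longrightarrow> \<Theta> s = P (H s))"
    if t: "t \<in> A \<union> B" for t
  proof (cases "t \<in> A \<and> t \<in> B")
    case True
    obtain P where P: "primitive_near \<omega> (H t) P" "\<forall>\<^sub>F s in nhds t. s \<in> A \<longrightarrow> \<Phi> s = P (H s)"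
      using \<Phi> True by (auto simp: primitive_along_def)
    obtain Q where Q: "primitive_near \<omega> (H t) Q" "\<forall>\<^sub>F s in nhds t. s \<in> B \<longrightarrow> \<Psi>' s = Q (H s)"
      using \<Psi>' True by (auto simp: primitive_along_def)
    have "P (H t) = Q (H t)"
      using eventually_nhds_x_imp_x[OF P(2)] eventually_nhds_x_imp_x[OF Q(2)] True agree by auto
    then have "\<forall>\<^sub>F s in nhds t. s \<in> A \<union> B \<longrightarrow> P (H s) = Q (H s)"
      using eventually_nhds_continuous_on[OF assms(5) t primitive_near_unique[OF P(1) Q(1)]] by simp
    with P(2) Q(2) have "\<forall>\<^sub>F s in nhds t. s \<in> A \<union> B \<longrightarrow> \<Theta> s = P (H s)"
      by eventually_elim (auto simp: \<Theta>A \<Theta>B)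
    with P(1) show ?thesis by blast
  next
    case False
    then consider "t \<in> A" "t \<notin> B" | "t \<in> B" "t \<notin> A" using t by blast
    then show ?thesis
    proof cases
      case 1
      obtain P where P: "primitive_near \<omega> (H t) P" "\<forall>\<^sub>F s in nhds t. s \<in> A \<longrightarrow> \<Phi> s = P (H s)"
        using \<Phi> 1 by (auto simp: primitive_along_def)
      from P(2) off[OF assms(2) 1(2)] have "\<forall>\<^sub>F s in nhds t. s \<in> A \<union> B \<longrightarrow> \<Theta> s = P (H s)"
        by eventually_elim (auto simp: \<Theta>A)
      with P(1) show ?thesis by blast
    next
      case 2
      obtain P where P: "primitive_near \<omega> (H t) P" "\<forall>\<^sub>F s in nhds t. s \<in> B \<longrightarrow> \<Psi>' s = P (H s)"
        using \<Psi>' 2 by (auto simp: primitive_along_def)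
      from P(2) off[OF assms(1) 2(2)] have "\<forall>\<^sub>F s in nhds t. s \<in> A \<union> B \<longrightarrow> \<Theta> s = P (H s)"
        by eventually_elim (auto simp: \<Theta>B)
      with P(1) show ?thesis by blast
    qed
  qed
  then show thesis using that unfolding primitive_along_def by blast
qed

text \<open>Being a primitive on a neighbourhood is an open condition on the point, so one P serves
  all parameters near t.\<close>

lemma primitive_along_locally:
  assumes "continuous_on UNIV H" "primitive_near \<omega> (H t) P"
  obtains T where "open T" "t \<in> T" "primitive_along \<omega> T H (\<lambda>s. P (H s))"
proof -
  have "\<forall>\<^sub>F y in nhds (H t). primitive_near \<omega> y P"
    using assms(2) unfolding primitive_near_def by (simp add: eventually_eventually)
  then have "\<forall>\<^sub>F s in nhds t. primitive_near \<omega> (H s) P"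
    using eventually_nhds_continuous_on[OF assms(1), of t] by simp
  then obtain T where "open T" "t \<in> T" "\<forall>s\<in>T. primitive_near \<omega> (H s) P"
    unfolding eventually_nhds by blast
  moreover from this have "primitive_along \<omega> T H (\<lambda>s. P (H s))"
    unfolding primitive_along_def by (intro ballI exI[of _ P]) simp
  ultimately show thesis using that by blast
qed

text \<open>Two bisection arguments take the place of a grid finer than a Lebesgue number: the
  second coordinate is treated over a thin strip around each s, and then the strips are joined in
  the first coordinate. All overlaps are segments, hence connected.\<close>

lemma primitive_along_rectangle:
  fixes H :: "real \<times> real \<Rightarrow> 'a::real_normed_vector"
  assumes H: "continuous_on UNIV H" and ex: "\<And>s. \<exists>P. primitive_near \<omega> (H s) P"
    and "a \<le> b" "c \<le> d"
  shows "\<exists>\<Phi>. primitive_along \<omega> ({a..b} \<times> {c..d}) H \<Phi>"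
proof -
  have strip: "\<exists>e>0. \<exists>\<Phi>. primitive_along \<omega> ({s-e..s+e} \<times> {c..d}) H \<Phi>" for s
    using \<open>c \<le> d\<close>
  proof (induction c d rule: Bolzano)
    case (trans p q r)
    obtain e \<Phi> where e: "e > 0" "primitive_along \<omega> ({s-e..s+e} \<times> {p..q}) H \<Phi>" using trans(1) by blast
    obtain f \<Psi> where f: "f > 0" "primitive_along \<omega> ({s-f..s+f} \<times> {q..r}) H \<Psi>" using trans(2) by blast
    \<comment> \<open>A common width for the two pieces, so that they meet in the full segment at
      height q.\<close>
    define k where "k = min e f"
    have k: "k > 0" "k \<le> e" "k \<le> f" using e f by (auto simp: k_def)
    have *: "({s-k..s+k} \<times> {p..q}) \<inter> ({s-k..s+k} \<times> {q..r}) = {s-k..s+k} \<times> {q}"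
      "({s-k..s+k} \<times> {p..q}) \<union> ({s-k..s+k} \<times> {q..r}) = {s-k..s+k} \<times> {p..r}"
      using trans(3,4) by auto
    obtain \<Theta> where "primitive_along \<omega> (({s-k..s+k} \<times> {p..q}) \<union> ({s-k..s+k} \<times> {q..r})) H \<Theta>"
    proof (rule primitive_along_glue)
      show "primitive_along \<omega> ({s-k..s+k} \<times> {p..q}) H \<Phi>"
        by (rule primitive_along_subset[OF e(2)]) (use k in auto)
      show "primitive_along \<omega> ({s-k..s+k} \<times> {q..r}) H \<Psi>"
        by (rule primitive_along_subset[OF f(2)]) (use k in auto)
    qed (use k H in \<open>auto simp: * intro!: closed_Times connected_Times continuous_on_subset[OF H]\<close>)
    then show ?case using k(1) unfolding * by blast
  next
    case (local t)
    obtain P where P: "primitive_near \<omega> (H (s, t)) P" using ex by blast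
    obtain T where T: "open T" "(s, t) \<in> T" "primitive_along \<omega> T H (\<lambda>s. P (H s))"
      using primitive_along_locally[OF H P] .
    from T(1,2) obtain X Y where XY: "open X" "open Y" "s \<in> X" "t \<in> Y" "X \<times> Y \<subseteq> T"
      by (elim open_prod_elim) auto
    obtain e where e: "e > 0" "cball s e \<subseteq> X" using XY open_contains_cball by blast
    obtain f where f: "f > 0" "ball t f \<subseteq> Y" using XY open_contains_ball by blast
    show ?case
    proof (rule exI[of _ f], intro conjI allI impI)
      fix p q assume "p \<le> t \<and> t \<le> q \<and> q - p < f"
      then have "{p..q} \<subseteq> ball t f" by (auto simp: dist_real_def)
      moreover have "{s-e..s+e} = cball s e" by (simp add: cball_eq_atLeastAtMost)
      ultimately have "{s-e..s+e} \<times> {p..q} \<subseteq> T" using e f XY(5) by blast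
      then show "\<exists>e>0. \<exists>\<Phi>. primitive_along \<omega> ({s-e..s+e} \<times> {p..q}) H \<Phi>"
        using e(1) primitive_along_subset[OF T(3)] by blast
    qed (rule f(1))
  qed
  show ?thesis
    using \<open>a \<le> b\<close>
  proof (induction a b rule: Bolzano)
    case (trans p q r)
    obtain \<Phi> where \<Phi>: "primitive_along \<omega> ({p..q} \<times> {c..d}) H \<Phi>" using trans(1) by blast
    obtain \<Psi> where \<Psi>: "primitive_along \<omega> ({q..r} \<times> {c..d}) H \<Psi>" using trans(2) by blast
    have *: "({p..q} \<times> {c..d}) \<inter> ({q..r} \<times> {c..d}) = {q} \<times> {c..d}"
      "({p..q} \<times> {c..d}) \<union> ({q..r} \<times> {c..d}) = {p..r} \<times> {c..d}"
      using trans(3,4) by auto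
    obtain \<Theta> where "primitive_along \<omega> (({p..q} \<times> {c..d}) \<union> ({q..r} \<times> {c..d})) H \<Theta>"
      by (rule primitive_along_glue[OF _ _ _ _ _ \<Phi> \<Psi>])
        (use \<open>c \<le> d\<close> in \<open>auto simp: * intro!: closed_Times connected_Times continuous_on_subset[OF H]\<close>)
    then show ?case unfolding * by blast
  next
    case (local s)
    obtain e \<Phi> where e: "e > 0" "primitive_along \<omega> ({s-e..s+e} \<times> {c..d}) H \<Phi>" using strip by blast
    show ?case
    proof (rule exI[of _ e], intro conjI allI impI)
      fix p q assume "p \<le> s \<and> s \<le> q \<and> q - p < e"
      then have "{p..q} \<times> {c..d} \<subseteq> {s-e..s+e} \<times> {c..d}" by auto
      then show "\<exists>\<Phi>. primitive_along \<omega> ({p..q} \<times> {c..d}) H \<Phi>"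
        using primitive_along_subset[OF e(2)] by blast
    qed (rule e(1))
  qed
qed

lemma primitive_along_square:
  fixes H :: "real \<times> real \<Rightarrow> 'a::real_normed_vector"
  assumes H: "continuous_on ({0..1} \<times> {0..1}) H" "H ` ({0..1} \<times> {0..1}) \<subseteq> U"
    and ex: "\<And>x. x \<in> U \<Longrightarrow> \<exists>P. primitive_near \<omega> x P"
  shows "\<exists>\<Phi>. primitive_along \<omega> ({0..1} \<times> {0..1}) H \<Phi>"
proof -
  \<comment> \<open>The retraction of the line onto [0, 1]. Composed with it in both coordinates, H
    extends continuously from the square to the plane, and its values stay in U.\<close>
  define clip :: "real \<Rightarrow> real" where "clip t = max 0 (min 1 t)" for t
  define K where "K y = H (clip (fst y), clip (snd y))" for y
  have clip: "clip t \<in> {0..1}" for t by (auto simp: clip_def)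
  have "continuous_on UNIV (\<lambda>y. (clip (fst y), clip (snd y)))"
    unfolding clip_def by (intro continuous_intros)
  then have "continuous_on UNIV K"
    unfolding K_def by (rule continuous_on_compose2[OF H(1)]) (use clip in auto)
  moreover have "\<exists>P. primitive_near \<omega> (K y) P" for y
    by (rule ex) (use H(2) clip in \<open>auto simp: K_def\<close>)
  ultimately obtain \<Phi> where "primitive_along \<omega> ({0..1} \<times> {0..1}) K \<Phi>"
    using primitive_along_rectangle[of K \<omega> 0 1 0 1] by auto
  then have "primitive_along \<omega> ({0..1} \<times> {0..1}) H \<Phi>"
    by (rule primitive_along_cong) (auto simp: K_def clip_def)
  then show ?thesis by blast
qed

section \<open>Integrals along paths and their homotopy invariance\<close>

lemma continuous_on_Pair_const: "continuous_on A (Pair a)"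
  by (rule continuous_on_Pair[OF continuous_on_const continuous_on_id])

lemma primitive_along_path:
  assumes "path p" "path_image p \<subseteq> U"
    and ex: "\<And>x. x \<in> U \<Longrightarrow> \<exists>P. primitive_near \<omega> x P"
  obtains \<Phi> where "primitive_along \<omega> {0..1} p \<Phi>"
proof -
  have c: "continuous_on {0..1} p" using assms(1) by (simp add: path_def)
  \<comment> \<open>The path is viewed as a map on the square that ignores the first
    coordinate.\<close>
  have "continuous_on ({0..1} \<times> {0..1}) (\<lambda>y. p (snd y))"
    by (rule continuous_on_compose2[OF c]) (auto intro: continuous_intros)
  moreover have "(\<lambda>y. p (snd y)) ` ({0..1} \<times> {0..1}) \<subseteq> U"
    using assms(2) by (auto simp: path_image_def)
  ultimately obtain \<Phi> where \<Phi>: "primitive_along \<omega> ({0..1::real} \<times> {0..1}) (\<lambda>y. p (snd y)) \<Phi>"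
    using primitive_along_square[OF _ _ ex] by blast
  have "Pair 0 ` {0..1} \<subseteq> {0..1::real} \<times> {0..1::real}"
    by auto
  from primitive_along_compose[OF \<Phi> continuous_on_Pair_const this]
  have "primitive_along \<omega> {0..1} p (\<lambda>s. \<Phi> (0, s))"
    by simp
  then show thesis using that by blast
qed

text \<open>Serves the two sides of a homotopy on which an endpoint of the path stays fixed; along
  them the increment is 0.\<close>

lemma primitive_along_const:
  assumes "primitive_near \<omega> x P"
  shows "primitive_along \<omega> A (\<lambda>_. x) (\<lambda>_. c)"
  unfolding primitive_along_def
  using primitive_near_add_const[OF assms, of "c - P x"] by (auto intro!: exI[of _ "\<lambda>y. P y + (c - P x)"])

text \<open>A function \<open>\<Theta>\<close> on the whole square is single-valued, so its
  increments around the boundary cancel. The sides with fixed endpoints contribute 0, which leaves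
  the increments along p and q equal.\<close>

lemma primitive_along_homotopic_paths:
  assumes hom: "homotopic_paths U p q"
    and ex: "\<And>x. x \<in> U \<Longrightarrow> \<exists>P. primitive_near \<omega> x P"
    and \<Phi>: "primitive_along \<omega> {0..1} p \<Phi>" and \<Psi>: "primitive_along \<omega> {0..1} q \<Psi>"
  shows "\<Phi> 1 - \<Phi> 0 = \<Psi> 1 - \<Psi> 0"
proof -
  obtain H where h: "continuous_on ({0..1::real} \<times> {0..1}) H" "H \<in> ({0..1} \<times> {0..1}) \<rightarrow> U"
    "\<forall>x\<in>{0..1}. H (0, x) = p x" "\<forall>x\<in>{0..1}. H (1, x) = q x"
    "\<forall>t\<in>{0..1}. pathstart (H \<circ> Pair t) = pathstart p \<and> pathfinish (H \<circ> Pair t) = pathfinish p"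
    using hom unfolding homotopic_paths by blast
  then have H: "continuous_on ({0..1} \<times> {0..1}) H" "H ` ({0..1} \<times> {0..1}) \<subseteq> U"
    "\<And>t. t \<in> {0..1} \<Longrightarrow> H (0, t) = p t" "\<And>t. t \<in> {0..1} \<Longrightarrow> H (1, t) = q t"
    "\<And>s. s \<in> {0..1} \<Longrightarrow> H (s, 0) = p 0" "\<And>s. s \<in> {0..1} \<Longrightarrow> H (s, 1) = p 1"
    by (auto simp: pathstart_def pathfinish_def image_subset_iff Pi_iff)
  obtain \<Theta> where \<Theta>: "primitive_along \<omega> ({0..1} \<times> {0..1}) H \<Theta>"
    using primitive_along_square[OF H(1,2) ex] by blast
  \<comment> \<open>The restriction of \<open>\<Theta>\<close> to a side and a given
    \<open>\<Xi>\<close> both belong to the same path, so they have the same increment.\<close>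
  have edge: "\<Theta> (g 1) - \<Theta> (g 0) = \<Xi> 1 - \<Xi> 0"
    if "continuous_on {0..1} g" "g ` {0..1} \<subseteq> {0..1} \<times> {0..1}" "\<And>s. s \<in> {0..1} \<Longrightarrow> H (g s) = c s"
      "primitive_along \<omega> {0..1} c \<Xi>" for g :: "real \<Rightarrow> real \<times> real" and c \<Xi>
  proof -
    have "continuous_on {0..1} (\<lambda>s. H (g s))"
      by (rule continuous_on_compose2[OF H(1) that(1,2)])
    then have "continuous_on {0..1} c"
      by (rule continuous_on_eq) (rule that(3))
    moreover have "primitive_along \<omega> {0..1} c (\<lambda>s. \<Theta> (g s))"
      by (rule primitive_along_cong[OF primitive_along_compose[OF \<Theta> that(1,2)]]) (auto simp: that(3))
    ultimately have "\<Theta> (g 1) - \<Xi> 1 = \<Theta> (g 0) - \<Xi> 0"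
      using that(4) by (intro primitive_along_diff_const[of "{0..1}" c \<omega> "\<lambda>s. \<Theta> (g s)" \<Xi>]) auto
    then show ?thesis by simp
  qed
  have "p 0 \<in> U" "p 1 \<in> U"
    using H(2) H(3)[of 0, symmetric] H(3)[of 1, symmetric] by (simp_all add: image_subset_iff)
  then obtain P0 P1 where P: "primitive_near \<omega> (p 0) P0" "primitive_near \<omega> (p 1) P1"
    using ex by metis
  have "\<Theta> (0, 1) - \<Theta> (0, 0) = \<Phi> 1 - \<Phi> 0"
    by (rule edge[of "\<lambda>t. (0, t)" p]) (use \<Phi> H in \<open>auto intro!: continuous_intros continuous_on_Pair_const\<close>)
  moreover have "\<Theta> (1, 1) - \<Theta> (1, 0) = \<Psi> 1 - \<Psi> 0"
    by (rule edge[of "\<lambda>t. (1, t)" q]) (use \<Psi> H in \<open>auto intro!: continuous_intros continuous_on_Pair_const\<close>)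
  moreover have "\<Theta> (1, 0) - \<Theta> (0, 0) = 0 - 0"
    by (rule edge[of "\<lambda>t. (t, 0)" "\<lambda>_. p 0"])
      (use H primitive_along_const[OF P(1)] in \<open>auto intro!: continuous_intros\<close>)
  moreover have "\<Theta> (1, 1) - \<Theta> (0, 1) = 0 - 0"
    by (rule edge[of "\<lambda>t. (t, 1)" "\<lambda>_. p 1"])
      (use H primitive_along_const[OF P(2)] in \<open>auto intro!: continuous_intros\<close>)
  ultimately show ?thesis by simp
qed

text \<open>f(x) is the integral along a chosen path from the base point a to x. Since any two paths
  in U with the same ends are homotopic, the chosen path to a nearby y can be traded for the one to
  x followed by a segment; near x, f is therefore a local primitive up to a constant.\<close>

lemma simply_connected_primitive:
  fixes U :: "'a::real_normed_vector set"
  assumes U: "open U" "simply_connected U"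
    and ex: "\<And>x. x \<in> U \<Longrightarrow> \<exists>P. primitive_near \<omega> x P"
  obtains f where "\<And>x. x \<in> U \<Longrightarrow> (f has_derivative \<omega> x) (at x)"
proof (cases "U = {}")
  case False
  then obtain a where a: "a \<in> U" by blast
  have sc: "path_connected U" "\<And>p q. path p \<Longrightarrow> path_image p \<subseteq> U \<Longrightarrow> path q \<Longrightarrow> path_image q \<subseteq> U \<Longrightarrow>
      pathstart q = pathstart p \<Longrightarrow> pathfinish q = pathfinish p \<Longrightarrow> homotopic_paths U p q"
    using U(2) unfolding simply_connected_eq_homotopic_paths by auto
  have "\<exists>p \<Phi>. path p \<and> path_image p \<subseteq> U \<and> pathstart p = a \<and> pathfinish p = x \<and> primitive_along \<omega> {0..1} p \<Phi>"
    if x: "x \<in> U" for x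
  proof -
    obtain p where p: "path p" "path_image p \<subseteq> U" "pathstart p = a" "pathfinish p = x"
      using sc(1)[unfolded path_connected_def, rule_format, OF a x] by blast
    obtain \<Phi> where "primitive_along \<omega> {0..1} p \<Phi>" by (rule primitive_along_path[OF p(1,2) ex])
    with p show ?thesis by blast
  qed
  then obtain p \<Phi> where p: "\<And>x. x \<in> U \<Longrightarrow> path (p x)" "\<And>x. x \<in> U \<Longrightarrow> path_image (p x) \<subseteq> U"
    "\<And>x. x \<in> U \<Longrightarrow> pathstart (p x) = a" "\<And>x. x \<in> U \<Longrightarrow> pathfinish (p x) = x"
    and \<Phi>: "\<And>x. x \<in> U \<Longrightarrow> primitive_along \<omega> {0..1} (p x) (\<Phi> x)" by metis
  define f where "f x = \<Phi> x 1 - \<Phi> x 0" for x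
  have "(f has_derivative \<omega> x) (at x)" if x: "x \<in> U" for x
  proof -
    obtain P where P: "primitive_near \<omega> x P" using ex x by blast
    then have "\<forall>\<^sub>F y in nhds x. y \<in> U \<and> (P has_derivative \<omega> y) (at y)"
      unfolding primitive_near_def using U(1) x eventually_nhds by (intro eventually_conj) auto
    then obtain r where r: "r > 0" "\<And>y. dist y x < r \<Longrightarrow> y \<in> U \<and> (P has_derivative \<omega> y) (at y)"
      unfolding eventually_nhds_metric by blast
    then have ball: "ball x r \<subseteq> U" "\<And>y. y \<in> ball x r \<Longrightarrow> primitive_near \<omega> y P"
      unfolding primitive_near_def eventually_nhds
      by (auto simp: dist_commute intro!: exI[of _ "ball x r"])
    have f_eq: "f y = f x + (P y - P x)" if y: "y \<in> ball x r" for y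
    proof -
      have yU: "y \<in> U" using ball(1) y by blast
      have seg: "closed_segment x y \<subseteq> ball x r"
        using y r(1) by (intro closed_segment_subset) auto
      \<comment> \<open>The comparison path. Its first half is \<open>p x\<close> run at double
        speed, its second half the segment, on which the increment is that of P.\<close>
      define q where "q = p x +++ linepath x y"
      have q: "path q" "path_image q \<subseteq> U" "pathstart q = a" "pathfinish q = y"
        unfolding q_def using p[OF x] seg ball(1)
        by (auto simp: path_image_join)
      obtain \<Theta> where \<Theta>: "primitive_along \<omega> {0..1} q \<Theta>"
        by (rule primitive_along_path[OF q(1,2) ex])
      have "f y = \<Theta> 1 - \<Theta> 0"
        unfolding f_def
        by (rule primitive_along_homotopic_paths[OF sc(2) ex \<Phi>[OF yU] \<Theta>])
          (use p[OF yU] q in auto)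
      moreover have "\<Theta> (1/2) - \<Theta> 0 = \<Phi> x 1 - \<Phi> x 0"
      proof -
        have "primitive_along \<omega> {0..1} (p x) (\<lambda>t. \<Theta> (t/2))"
          by (rule primitive_along_cong[OF primitive_along_compose[OF \<Theta>, of "{0..1}" "\<lambda>t. t/2"]])
            (auto simp: q_def joinpaths_def intro!: continuous_intros)
        from primitive_along_diff_const[OF _ _ this \<Phi>[OF x], of 1 0] p(1)[OF x]
        show ?thesis by (simp add: path_def)
      qed
      moreover have "\<Theta> 1 - \<Theta> (1/2) = P y - P x"
      proof -
        have "primitive_along \<omega> {0..1} (linepath x y) (\<lambda>t. \<Theta> ((t+1)/2))"
        proof (rule primitive_along_cong[OF primitive_along_compose[OF \<Theta>, of "{0..1}" "\<lambda>t. (t+1)/2"]])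
          fix s :: real assume "s \<in> {0..1}"
          moreover have *: "2 * ((s+1)/2) - 1 = s" by (simp add: field_simps)
          \<comment> \<open>At s = 0 the parameter is 1/2, which \<open>joinpaths\<close> assigns to
            its first branch; the value there is the end of \<open>p x\<close>, that is x, and
            agrees with the start of the segment.\<close>
          ultimately show "q ((s+1)/2) = linepath x y s"
            using p(4)[OF x] unfolding q_def joinpaths_def *
            by (cases "s = 0") (auto simp: pathfinish_def linepath_0')
        qed (auto intro!: continuous_intros)
        moreover have "primitive_along \<omega> {0..1} (linepath x y) (\<lambda>t. P (linepath x y t))"
          unfolding primitive_along_def
        proof
          fix t :: real assume "t \<in> {0..1}"
          then have "linepath x y t \<in> ball x r" using seg linepath_in_path by blast
          then show "\<exists>P'. primitive_near \<omega> (linepath x y t) P' \<and>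
              (\<forall>\<^sub>F s in nhds t. s \<in> {0..1} \<longrightarrow> P (linepath x y s) = P' (linepath x y s))"
            using ball(2) by (intro exI[of _ P]) simp
        qed
        ultimately have "\<Theta> ((1+1)/2) - P (linepath x y 1) = \<Theta> ((0+1)/2) - P (linepath x y 0)"
          by (rule primitive_along_diff_const[rotated 2]) auto
        then show ?thesis by (simp add: linepath_0' linepath_1')
      qed
      ultimately show ?thesis by (simp add: f_def)
    qed
    have "((\<lambda>y. f x + (P y - P x)) has_derivative \<omega> x) (at x)"
      using r(2)[of x] r(1) by (auto intro!: derivative_eq_intros)
    then show ?thesis
    proof (rule has_derivative_transform_within_open[OF _ open_ball[of x r]])
      show "x \<in> ball x r" using r(1) by simp
      show "f x + (P y - P x) = f y" if "y \<in> ball x r" for y using f_eq[OF that] by (rule sym)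
    qed
  qed
  then show thesis using that by blast
qed (use that in blast)

text \<open>Balls are convex, so each point of U has a local primitive, and simple connectedness
  joins these to a global one. Its partial derivatives are the smooth \<open>p i\<close>, which
  makes it smooth.\<close>

lemma closed_form_exact:
  fixes p :: "'n::finite \<Rightarrow> real^'n \<Rightarrow> real"
  assumes U: "open U" "simply_connected U" and p: "\<And>i. smooth_on U (p i)"
    and closed: "\<And>x i j. x \<in> U \<Longrightarrow> partial j (p i) x = partial i (p j) x"
  shows "\<exists>f. smooth_on U f \<and> (\<forall>x\<in>U. \<forall>i. partial i f x = p i x)"
proof -
  define w where "w x = (\<chi> i. p i x)" for x
  define w' where "w' x v = (\<chi> i. \<Sum>j\<in>UNIV. v $ j *\<^sub>R partial j (p i) x)" for x v
  have w: "(w has_derivative w' x) (at x)" if "x \<in> U" for x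
    unfolding w_def w'_def
    by (subst has_derivative_componentwise_within)
      (auto simp: Basis_vec_def inner_axis
        intro: has_derivative_partials[OF smooth_on_differentiable[OF p that], simplified])
  have sym: "w' x u \<bullet> v = w' x v \<bullet> u" if "x \<in> U" for x u v
  proof -
    have "w' x u \<bullet> v = (\<Sum>i\<in>UNIV. \<Sum>j\<in>UNIV. u $ j * v $ i * partial j (p i) x)"
      by (simp add: w'_def inner_vec_def sum_distrib_left sum_distrib_right mult_ac)
    also have "\<dots> = (\<Sum>j\<in>UNIV. \<Sum>i\<in>UNIV. u $ j * v $ i * partial j (p i) x)"
      by (rule sum.swap)
    also have "\<dots> = w' x v \<bullet> u"
      by (simp add: w'_def inner_vec_def sum_distrib_left sum_distrib_right mult_ac closed[OF that])
    finally show ?thesis .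
  qed
  have cont: "continuous_on U (\<lambda>x. w' x v)" for v
    unfolding w'_def
    by (intro continuous_intros smooth_on_imp_continuous_on smooth_on_partial p)
  have "\<exists>P. primitive_near (\<lambda>x v. w x \<bullet> v) x P" if x: "x \<in> U" for x
  proof -
    obtain r where r: "r > 0" "ball x r \<subseteq> U" using U(1) x open_contains_ball by blast
    obtain P where "\<And>y. y \<in> ball x r \<Longrightarrow> (P has_derivative (\<lambda>v. w y \<bullet> v)) (at y)"
    proof (rule star_primitive[of "ball x r" w w'])
      show "continuous_on (ball x r) (\<lambda>x. w' x v)" for v by (rule continuous_on_subset[OF cont r(2)])
    qed (use w sym r(2) in \<open>auto simp: subset_iff\<close>)
    then have "primitive_near (\<lambda>x v. w x \<bullet> v) x P"
      unfolding primitive_near_def eventually_nhds using r(1) by (intro exI[of _ "ball x r"]) auto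
    then show ?thesis by blast
  qed
  then obtain f where f: "\<And>x. x \<in> U \<Longrightarrow> (f has_derivative (\<lambda>v. w x \<bullet> v)) (at x)"
    using simply_connected_primitive[OF U] by blast
  show ?thesis
  proof (intro exI[of _ f] conjI ballI allI)
    show "partial i f x = p i x" if "x \<in> U" for x i
      using partial_eqI[OF f[OF that]] by (simp add: w_def inner_axis)
    show "smooth_on U f"
      by (rule smooth_on_partialsI[OF U(1) _ p]) (use f in \<open>simp add: w_def inner_vec_def\<close>)
  qed
qed

section \<open>Flat centroaffine metrics\<close>

lemma partial_const: "partial i (\<lambda>_. c) u = 0"
  unfolding partial_def by simp

lemma partial_add:
  "f differentiable (at u) \<Longrightarrow> g differentiable (at u) \<Longrightarrow>
   partial i (\<lambda>v. f v + g v) u = partial i f u + partial i g u"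
  using partial_eqI[OF has_derivative_add[OF frechet_derivative_works[THEN iffD1]
        frechet_derivative_works[THEN iffD1]]]
  by (simp add: partial_def)

lemma partial_sum:
  assumes "\<And>a. a \<in> A \<Longrightarrow> f a differentiable (at u)"
  shows "partial i (\<lambda>v. \<Sum>a\<in>A. f a v) u = (\<Sum>a\<in>A. partial i (f a) u)"
  using partial_eqI[OF has_derivative_sum[OF frechet_derivative_works[THEN iffD1, OF assms]]]
  by (simp add: partial_def)

lemma partial_scaleR:
  fixes a :: "real^'n::finite \<Rightarrow> real"
  assumes "a differentiable (at u)" "f differentiable (at u)"
  shows "partial i (\<lambda>v. a v *\<^sub>R f v) u = a u *\<^sub>R partial i f u + partial i a u *\<^sub>R f u"
  using partial_eqI[OF has_derivative_scaleR[OF assms[THEN frechet_derivative_works[THEN iffD1]]]]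
  by (simp add: partial_def)

lemma partial_cmult:
  fixes f :: "real^'n::finite \<Rightarrow> real"
  assumes "f differentiable (at u)"
  shows "partial i (\<lambda>v. c * f v) u = c * partial i f u"
  using partial_scaleR[of "\<lambda>_. c" u f i] assms by (simp add: partial_const)

text \<open>The constancy is asked on U only, because the metric of a hypersurface is controlled
  only on its domain.\<close>

lemma christoffel_constant:
  assumes "open U" "u \<in> U" "\<And>v. v \<in> U \<Longrightarrow> g v = \<eta>"
  shows "christoffel g k i j u = 0"
proof -
  have "partial a (\<lambda>v. g v $ b $ c) u = 0" for a b c
    using partial_cong_open[OF assms(1,2), of "\<lambda>v. g v $ b $ c" "\<lambda>_. \<eta> $ b $ c" a] assms(3)
    by (simp add: partial_const)
  then show ?thesis by (simp add: christoffel_def)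
qed

lemma gauss_codazzi_constant:
  "gauss_codazzi U (\<lambda>_. \<eta>) h \<longleftrightarrow>
     (\<forall>u\<in>U. \<forall>i j k. (\<Sum>s\<in>UNIV. h s i j u * \<eta> $ s $ k) = (\<Sum>s\<in>UNIV. h s i k u * \<eta> $ s $ j)) \<and>
     (\<forall>u\<in>U. \<forall>s i j k. partial k (h s i j) u = partial j (h s i k) u) \<and>
     (\<forall>u\<in>U. \<forall>s i j k. (\<Sum>p\<in>UNIV. h p i j u * h s p k u) - (\<Sum>p\<in>UNIV. h p i k u * h s p j u)
        = \<eta> $ i $ k * delta s j - \<eta> $ i $ j * delta s k)"
proof -
  have c: "christoffel (\<lambda>_. \<eta>) = (\<lambda>k i j u. 0)"
    using christoffel_constant[of UNIV _ "\<lambda>_. \<eta>" \<eta>] by (simp add: fun_eq_iff)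
  then have "riemann (\<lambda>_. \<eta>) s i j k u = 0" for s i j k u
    by (simp add: riemann_def partial_const)
  with c show ?thesis by (simp add: gauss_codazzi_def cov_deriv_def)
qed

lemma matrix_inv_cancel:
  fixes \<eta> :: "real^'n::finite^'n"
  assumes "invertible \<eta>"
  shows "(\<Sum>k\<in>UNIV. matrix_inv \<eta> $ s $ k * \<eta> $ k $ q) = delta s q"
    and "(\<Sum>k\<in>UNIV. \<eta> $ s $ k * matrix_inv \<eta> $ k $ q) = delta s q"
proof -
  have "\<eta> ** matrix_inv \<eta> = mat 1 \<and> matrix_inv \<eta> ** \<eta> = mat 1"
    using assms unfolding invertible_def matrix_inv_def by (rule someI_ex)
  then have "(matrix_inv \<eta> ** \<eta>) $ s $ q = mat 1 $ s $ q" "(\<eta> ** matrix_inv \<eta>) $ s $ q = mat 1 $ s $ q"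
    by simp_all
  then show "(\<Sum>k\<in>UNIV. matrix_inv \<eta> $ s $ k * \<eta> $ k $ q) = delta s q"
    and "(\<Sum>k\<in>UNIV. \<eta> $ s $ k * matrix_inv \<eta> $ k $ q) = delta s q"
    by (simp_all add: matrix_matrix_mult_def mat_def delta_def)
qed

lemma sum_delta_mult:
  fixes f :: "'n::finite \<Rightarrow> real"
  shows "(\<Sum>q\<in>UNIV. delta s q * f q) = f s" "(\<Sum>q\<in>UNIV. f q * delta s q) = f s"
    "(\<Sum>q\<in>UNIV. delta q s * f q) = f s" "(\<Sum>q\<in>UNIV. f q * delta q s) = f s"
proof -
  have "delta s q * f q = (if q = s then f q else 0)" "f q * delta s q = (if q = s then f q else 0)"
    "delta q s * f q = (if q = s then f q else 0)" "f q * delta q s = (if q = s then f q else 0)" for q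
    by (simp_all add: delta_def)
  then show "(\<Sum>q\<in>UNIV. delta s q * f q) = f s" "(\<Sum>q\<in>UNIV. f q * delta s q) = f s"
    "(\<Sum>q\<in>UNIV. delta q s * f q) = f s" "(\<Sum>q\<in>UNIV. f q * delta q s) = f s"
    by simp_all
qed

lemma raise_lower_index:
  fixes \<eta> :: "real^'n::finite^'n"
  assumes "invertible \<eta>"
  shows "(\<Sum>k\<in>UNIV. matrix_inv \<eta> $ s $ k * (\<Sum>q\<in>UNIV. \<eta> $ k $ q * a q)) = a s"
    and "(\<Sum>k\<in>UNIV. \<eta> $ s $ k * (\<Sum>q\<in>UNIV. matrix_inv \<eta> $ k $ q * a q)) = a s"
proof -
  have *: "(\<Sum>k\<in>UNIV. A k * (\<Sum>q\<in>UNIV. B k q * a q)) = (\<Sum>q\<in>UNIV. (\<Sum>k\<in>UNIV. A k * B k q) * a q)"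
    for A :: "'n \<Rightarrow> real" and B :: "'n \<Rightarrow> 'n \<Rightarrow> real"
  proof -
    have "(\<Sum>k\<in>UNIV. A k * (\<Sum>q\<in>UNIV. B k q * a q)) = (\<Sum>k\<in>UNIV. \<Sum>q\<in>UNIV. A k * B k q * a q)"
      by (simp add: sum_distrib_left mult.assoc)
    also have "\<dots> = (\<Sum>q\<in>UNIV. \<Sum>k\<in>UNIV. A k * B k q * a q)"
      by (rule sum.swap)
    finally show ?thesis by (simp add: sum_distrib_right)
  qed
  show "(\<Sum>k\<in>UNIV. matrix_inv \<eta> $ s $ k * (\<Sum>q\<in>UNIV. \<eta> $ k $ q * a q)) = a s"
    and "(\<Sum>k\<in>UNIV. \<eta> $ s $ k * (\<Sum>q\<in>UNIV. matrix_inv \<eta> $ k $ q * a q)) = a s"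
    unfolding * matrix_inv_cancel[OF assms] sum_delta_mult by (rule refl)+
qed

lemma symmetric_matrix_component:
  "transpose \<eta> = \<eta> \<Longrightarrow> \<eta> $ i $ j = \<eta> $ j $ i"
  by (metis transpose_def vec_lambda_beta)

text \<open>Compatibility of the linear system couples the Gauss and Codazzi equations. After
  lowering \<open>s\<close>, the Codazzi part is symmetric and the Gauss part is skew in \<open>s\<close> and \<open>i\<close>,
  so both hold separately.\<close>

lemma split_gauss_codazzi:
  fixes \<eta> :: "real^'n::finite^'n" and h :: "'n tensor12"
  assumes U: "open U" and \<eta>: "transpose \<eta> = \<eta>" "invertible \<eta>"
    and h: "\<And>s i j. smooth_on U (h s i j)" and hs: "\<And>u s i j. u \<in> U \<Longrightarrow> h s i j u = h s j i u"
    and low: "\<And>u i j k. u \<in> U \<Longrightarrow> (\<Sum>s\<in>UNIV. h s i j u * \<eta> $ s $ k) = (\<Sum>s\<in>UNIV. h s i k u * \<eta> $ s $ j)"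
    and comp: "\<And>u s i j k. u \<in> U \<Longrightarrow>
      partial k (h s i j) u + (\<Sum>p\<in>UNIV. h p i j u * h s p k u) + \<eta> $ i $ j * delta s k
      = partial j (h s i k) u + (\<Sum>p\<in>UNIV. h p i k u * h s p j u) + \<eta> $ i $ k * delta s j"
  shows "gauss_codazzi U (\<lambda>_. \<eta>) h"
proof -
  \<comment> \<open>The tensor h with its upper index lowered. Together with the symmetry of h in
    its lower indices, the hypothesis \<open>low\<close> makes it totally symmetric.\<close>
  define H where "H l i j v = (\<Sum>s\<in>UNIV. \<eta> $ l $ s * h s i j v)" for l i j v
  note \<eta>s = symmetric_matrix_component[OF \<eta>(1)]
  have H_low: "H l i j v = (\<Sum>s\<in>UNIV. h s i j v * \<eta> $ s $ l)" for l i j v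
    unfolding H_def by (rule sum.cong) (use \<eta>s[of l] in \<open>simp_all add: mult.commute\<close>)
  have H_swap: "H l i j v = H i l j v" if "v \<in> U" for l i j v
  proof -
    have "H l i j v = (\<Sum>s\<in>UNIV. h s j i v * \<eta> $ s $ l)"
      unfolding H_low using hs[OF that] by simp
    also have "\<dots> = (\<Sum>s\<in>UNIV. h s j l v * \<eta> $ s $ i)" by (rule low[OF that])
    also have "\<dots> = H i l j v" unfolding H_low using hs[OF that] by simp
    finally show ?thesis .
  qed
  have dH: "partial k (H l i j) u = (\<Sum>s\<in>UNIV. \<eta> $ l $ s * partial k (h s i j) u)" if "u \<in> U" for k l i j u
    unfolding H_def
    by (subst partial_sum) (use smooth_on_differentiable[OF h that] in \<open>auto simp: partial_cmult\<close>)
  have dH_swap: "partial k (H l i j) u = partial k (H i l j) u" if "u \<in> U" for k l i j u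
    by (rule partial_cong_open[OF U that H_swap])
  have main: "partial k (h s i j) u = partial j (h s i k) u" if u: "u \<in> U" for s i j k u
  proof -
    \<comment> \<open>The quadratic term with s lowered to l. By symmetry of \<open>H\<close> it
      equals eta(h_ij, h_lk) - eta(h_ik, h_lj), where h_ij is the vector with components h^s_ij; in
      this form the exchange of l and i visibly changes its sign.\<close>
    define Y where "Y l i = (\<Sum>s\<in>UNIV. \<Sum>t\<in>UNIV. \<eta> $ s $ t * (h s i j u * h t l k u - h s i k u * h t l j u))" for l i
    have X: "partial k (H l i j) u - partial j (H l i k) u + Y l i
        = \<eta> $ i $ k * \<eta> $ l $ j - \<eta> $ i $ j * \<eta> $ l $ k" for l i
    proof -
      have hh: "(\<Sum>q\<in>UNIV. \<eta> $ l $ q * (\<Sum>p\<in>UNIV. h p i a u * h q p b u))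
          = (\<Sum>s\<in>UNIV. \<Sum>t\<in>UNIV. \<eta> $ s $ t * (h s i a u * h t l b u))" for a b
      proof -
        have "(\<Sum>q\<in>UNIV. \<eta> $ l $ q * (\<Sum>p\<in>UNIV. h p i a u * h q p b u))
            = (\<Sum>p\<in>UNIV. h p i a u * H l p b u)"
          unfolding H_def sum_distrib_left by (subst sum.swap) (simp add: mult_ac)
        also have "\<dots> = (\<Sum>p\<in>UNIV. h p i a u * H p l b u)"
          using H_swap[OF u] by simp
        also have "\<dots> = (\<Sum>s\<in>UNIV. \<Sum>t\<in>UNIV. \<eta> $ s $ t * (h s i a u * h t l b u))"
          unfolding H_def sum_distrib_left by (simp add: mult_ac)
        finally show ?thesis .
      qed
      have "(\<Sum>q\<in>UNIV. \<eta> $ l $ q * (partial k (h q i j) u + (\<Sum>p\<in>UNIV. h p i j u * h q p k u) + \<eta> $ i $ j * delta q k))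
        = (\<Sum>q\<in>UNIV. \<eta> $ l $ q * (partial j (h q i k) u + (\<Sum>p\<in>UNIV. h p i k u * h q p j u) + \<eta> $ i $ k * delta q j))"
        by (simp add: comp[OF u, of k])
      moreover have "(\<Sum>q\<in>UNIV. \<eta> $ l $ q * (\<eta> $ i $ a * delta q b)) = \<eta> $ l $ b * \<eta> $ i $ a" for a b
        using sum_delta_mult(4)[of "\<lambda>q. \<eta> $ l $ q * \<eta> $ i $ a" b] by (simp add: mult.assoc)
      ultimately show ?thesis
        unfolding Y_def right_diff_distrib sum_subtractf hh[symmetric] dH[OF u]
        by (simp add: distrib_left sum.distrib mult.commute)
    qed
    have skew: "Y l i = - Y i l" for l i
    proof -
      have "Y l i = (\<Sum>t\<in>UNIV. \<Sum>s\<in>UNIV. \<eta> $ s $ t * (h s i j u * h t l k u - h s i k u * h t l j u))"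
        unfolding Y_def by (rule sum.swap)
      also have "\<dots> = - Y i l"
        unfolding Y_def sum_negf[symmetric]
        by (intro sum.cong refl) (use \<eta>s in \<open>simp add: algebra_simps\<close>)
      finally show ?thesis .
    qed
    \<comment> \<open>In \<open>X\<close> the right-hand side is skew in l and i just as
      \<open>Y\<close> is, while the difference of derivatives is symmetric. Adding the equations
      for (l, i) and (i, l) leaves twice that difference equal to 0.\<close>
    have zero: "partial k (H l i j) u = partial j (H l i k) u" for l
      using X[of l i] X[of i l] skew[of l i] dH_swap[OF u, of k l i j] dH_swap[OF u, of j l i k] \<eta>s[of l]
      by (simp add: mult.commute)
    have "partial k (h s i j) u = (\<Sum>l\<in>UNIV. matrix_inv \<eta> $ s $ l * partial k (H l i j) u)"
      unfolding dH[OF u] by (rule raise_lower_index(1)[OF \<eta>(2), symmetric])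
    also have "\<dots> = (\<Sum>l\<in>UNIV. matrix_inv \<eta> $ s $ l * partial j (H l i k) u)"
      by (simp add: zero)
    also have "\<dots> = partial j (h s i k) u"
      unfolding dH[OF u] by (rule raise_lower_index(1)[OF \<eta>(2)])
    finally show ?thesis .
  qed
  have gauss: "(\<Sum>p\<in>UNIV. h p i j u * h s p k u) - (\<Sum>p\<in>UNIV. h p i k u * h s p j u)
        = \<eta> $ i $ k * delta s j - \<eta> $ i $ j * delta s k" if "u \<in> U" for u s i j k
    using comp[OF that, of k s i j] main[OF that, of k s i j] by simp
  show ?thesis
    unfolding gauss_codazzi_constant using low main gauss by blast
qed

section \<open>Compatibility of the moving frame of a hypersurface with constant metric\<close>

lemma frame_coefficients_unique:
  fixes r :: "real^'n::finite \<Rightarrow> real^'m::finite"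
  assumes "CARD('m) = CARD('n) + 1" "centroaffine_hypersurface U r" "u \<in> U"
    and "(\<Sum>k\<in>UNIV. a k *\<^sub>R partial k r u) + b *\<^sub>R r u = (\<Sum>k\<in>UNIV. a' k *\<^sub>R partial k r u) + b' *\<^sub>R r u"
  shows "a k = a' k" "b = b'"
proof -
  let ?w = "(\<Sum>k\<in>UNIV. a k *\<^sub>R partial k r u) + b *\<^sub>R r u"
  have "((\<chi> k. a k) :: real^'n, b) = (\<chi> k. a' k, b')"
  proof (rule ex1E[OF centroaffine_coeffs_exists_unique[OF assms(1-3), of ?w]])
    fix p assume "\<forall>q. ?w = (\<Sum>k\<in>UNIV. fst q $ k *\<^sub>R partial k r u) + snd q *\<^sub>R r u \<longrightarrow> q = p"
    from this[rule_format, of "(\<chi> k. a k, b)"] this[rule_format, of "(\<chi> k. a' k, b')"] assms(4)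
    show ?thesis by simp
  qed
  then show "a k = a' k" "b = b'" by (auto simp: vec_eq_iff)
qed

locale flat_centroaffine =
  fixes U :: "(real^'n::finite) set" and r :: "real^'n \<Rightarrow> real^'m::finite" and \<eta> :: "real^'n^'n"
  assumes dim: "CARD('m) = CARD('n) + 1" and U: "open U"
    and hyp: "centroaffine_hypersurface U r"
    and flat: "\<And>u. u \<in> U \<Longrightarrow> centroaffine_metric r u = \<eta>"
begin

abbreviation "h \<equiv> centroaffine_h r"

lemma r_smooth: "smooth_on U r"
  using hyp by (simp add: centroaffine_hypersurface_def)

lemma second_derivative:
  assumes u: "u \<in> U"
  shows "partial i (partial j r) u = (\<Sum>k\<in>UNIV. h k i j u *\<^sub>R partial k r u) + \<eta> $ i $ j *\<^sub>R r u"
proof -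
  have "partial i (partial j r) u =
      (\<Sum>k\<in>UNIV. fst (centroaffine_coeffs r i j u) $ k *\<^sub>R partial k r u) + snd (centroaffine_coeffs r i j u) *\<^sub>R r u"
    unfolding centroaffine_coeffs_def
    by (rule theI'[OF centroaffine_coeffs_exists_unique[OF dim hyp u]])
  moreover have "snd (centroaffine_coeffs r i j u) = \<eta> $ i $ j"
    using flat[OF u] by (simp add: centroaffine_metric_def vec_eq_iff)
  \<comment> \<open>The Christoffel symbols of a constant metric vanish, so h is the whole induced
    connection.\<close>
  moreover have "fst (centroaffine_coeffs r i j u) $ k = h k i j u" for k
    using christoffel_constant[OF U u flat]
    by (simp add: centroaffine_h_def centroaffine_connection_def)
  ultimately show ?thesis by simp
qed

lemma h_symmetric:
  assumes u: "u \<in> U"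
  shows "h k i j u = h k j i u" "\<eta> $ i $ j = \<eta> $ j $ i"
  using partial_commute[OF U r_smooth u, of i j]
  unfolding second_derivative[OF u]
  by (rule frame_coefficients_unique[OF dim hyp u])+

text \<open>The coefficients solve a linear system whose columns are r and its first derivatives and
  whose right-hand side is a second derivative of r. Cramer's rule writes them as quotients of
  determinants with smooth entries.\<close>

lemma h_smooth: "smooth_on U (h k i j)"
proof -
  \<comment> \<open>Determinants need one index type for rows and columns. The bijection
    \<open>\<sigma>\<close> renames the coordinates of the ambient space by
    \<open>'n option\<close>, the index type of the frame.\<close>
  have "CARD('n option) = CARD('m)" using dim by (simp add: card_UNIV_option)
  then obtain \<sigma> :: "'n option \<Rightarrow> 'm" where \<sigma>: "bij \<sigma>"
    using finite_same_card_bij[of "UNIV :: 'n option set" "UNIV :: 'm set"] by auto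
  define A :: "real^'n \<Rightarrow> real^('n option)^('n option)" where "A u = (\<chi> a b. frame r u b $ \<sigma> a)" for u
  define y where "y u = (\<chi> a. partial i (partial j r) u $ \<sigma> a)" for u
  define x where "x u = (\<chi> a. case a of None \<Rightarrow> \<eta> $ i $ j | Some k \<Rightarrow> h k i j u)" for u
  have A_mult: "(A u *v z) $ a = ((\<Sum>k\<in>UNIV. z $ Some k *\<^sub>R partial k r u) + z $ None *\<^sub>R r u) $ \<sigma> a" for u z a
    by (simp add: A_def matrix_vector_mult_def sum_option_UNIV mult.commute add.commute)
  have Ax: "A u *v x u = y u" if "u \<in> U" for u
    unfolding vec_eq_iff A_mult by (simp add: x_def y_def second_derivative[OF that])
  \<comment> \<open>Linear independence of the frame, in the form of uniqueness of coefficients,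
    gives the matrix trivial kernel.\<close>
  have det: "det (A u) \<noteq> 0" if "u \<in> U" for u
  proof -
    have "z = 0" if z: "A u *v z = 0" for z
    proof -
      let ?w = "(\<Sum>k\<in>UNIV. z $ Some k *\<^sub>R partial k r u) + z $ None *\<^sub>R r u"
      have "?w $ b = 0" for b
        using z A_mult[of u z "inv \<sigma> b"] surj_f_inv_f[OF bij_is_surj[OF \<sigma>], of b] by simp
      then have "?w = (\<Sum>k\<in>UNIV. 0 *\<^sub>R partial k r u) + 0 *\<^sub>R r u"
        by (simp only: vec_eq_iff zero_index scale_zero_left sum.neutral_const add_0 simp_thms)
      note zero = frame_coefficients_unique[OF dim hyp \<open>u \<in> U\<close> this]
      have "z $ a = 0" for a
        by (cases a) (simp_all add: zero)
      then show ?thesis by (simp add: vec_eq_iff)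
    qed
    then have "\<exists>B. B ** A u = mat 1"
      unfolding matrix_left_invertible_ker by blast
    then show ?thesis
      unfolding invertible_det_nz[symmetric] invertible_left_inverse .
  qed
  \<comment> \<open>The numerator in Cramer's rule: the column of the k-th tangent vector is
    replaced by the right-hand side.\<close>
  define B where "B u = (\<chi> a b. if b = Some k then y u $ a else A u $ a $ b)" for u
  have "h k i j u = det (B u) * inverse (det (A u))" if "u \<in> U" for u
  proof -
    have "x u = (\<chi> k. det (\<chi> i j. if j = k then y u $ i else A u $ i $ j) / det (A u))"
      using cramer[OF det[OF that]] Ax[OF that] by blast
    then have "x u $ Some k = det (B u) / det (A u)" by (simp add: B_def)
    then show ?thesis by (simp add: x_def divide_inverse)
  qed
  moreover have A: "smooth_on U (\<lambda>u. A u $ a $ b)" for a b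
    using smooth_on_component[OF U r_smooth] smooth_on_component[OF U smooth_on_partial[OF r_smooth]]
    by (cases b) (simp_all add: A_def)
  moreover have "smooth_on U (\<lambda>u. B u $ a $ b)" for a b
    using A smooth_on_component[OF U smooth_on_partial[OF smooth_on_partial[OF r_smooth]]]
    by (cases "b = Some k") (simp_all add: B_def y_def)
  ultimately show ?thesis
    using smooth_on_cong[OF U, of "h k i j" "\<lambda>u. det (B u) * inverse (det (A u))"]
    by (simp add: smooth_on_mult[OF U] smooth_on_inverse[OF U] smooth_on_det[OF U] det)
qed

text \<open>The second derivatives of r that appear under differentiation are eliminated by the
  system itself. What remains is an expansion in the frame, whose coefficients can be compared one
  by one.\<close>

lemma third_derivative:
  assumes u: "u \<in> U"
  shows "partial k (partial i (partial j r)) u =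
     (\<Sum>q\<in>UNIV. (partial k (h q i j) u + (\<Sum>p\<in>UNIV. h p i j u * h q p k u) + \<eta> $ i $ j * delta q k) *\<^sub>R partial q r u)
     + (\<Sum>s\<in>UNIV. h s i j u * \<eta> $ s $ k) *\<^sub>R r u"
proof -
  have d: "r differentiable (at u)" "partial s r differentiable (at u)" "h s i j differentiable (at u)" for s
    using smooth_on_differentiable[OF _ u] r_smooth smooth_on_partial h_smooth by blast+
  have "partial k (partial i (partial j r)) u
      = partial k (\<lambda>v. (\<Sum>s\<in>UNIV. h s i j v *\<^sub>R partial s r v) + \<eta> $ i $ j *\<^sub>R r v) u"
    by (rule partial_cong_open[OF U u]) (rule second_derivative)
  also have "\<dots> = (\<Sum>s\<in>UNIV. h s i j u *\<^sub>R partial k (partial s r) u + partial k (h s i j) u *\<^sub>R partial s r u)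
      + \<eta> $ i $ j *\<^sub>R partial k r u"
    using d by (simp add: partial_add partial_sum partial_scaleR partial_const)
  also have "\<dots> = (\<Sum>s\<in>UNIV. h s i j u *\<^sub>R ((\<Sum>q\<in>UNIV. h q s k u *\<^sub>R partial q r u) + \<eta> $ s $ k *\<^sub>R r u))
      + (\<Sum>q\<in>UNIV. partial k (h q i j) u *\<^sub>R partial q r u) + \<eta> $ i $ j *\<^sub>R partial k r u"
    unfolding second_derivative[OF u] using h_symmetric[OF u] by (simp add: sum.distrib)
  also have "(\<Sum>s\<in>UNIV. h s i j u *\<^sub>R ((\<Sum>q\<in>UNIV. h q s k u *\<^sub>R partial q r u) + \<eta> $ s $ k *\<^sub>R r u))
      = (\<Sum>q\<in>UNIV. (\<Sum>s\<in>UNIV. h s i j u * h q s k u) *\<^sub>R partial q r u) + (\<Sum>s\<in>UNIV. h s i j u * \<eta> $ s $ k) *\<^sub>R r u"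
    unfolding scaleR_add_right sum.distrib scaleR_sum_right scaleR_sum_left
    by (subst sum.swap) simp
  also have "\<eta> $ i $ j *\<^sub>R partial k r u = (\<Sum>q\<in>UNIV. (\<eta> $ i $ j * delta q k) *\<^sub>R partial q r u)"
  proof -
    have "(\<eta> $ i $ j * delta q k) *\<^sub>R partial q r u = (if q = k then \<eta> $ i $ j *\<^sub>R partial q r u else 0)" for q
      by (simp add: delta_def)
    then show ?thesis by simp
  qed
  finally show ?thesis
    by (simp add: scaleR_add_left sum.distrib add.commute add.left_commute)
qed

lemma gauss_codazzi_h:
  assumes "transpose \<eta> = \<eta>" "invertible \<eta>"
  shows "gauss_codazzi U (\<lambda>_. \<eta>) h"
proof -
  \<comment> \<open>Third derivatives of r are symmetric. The exchange of k and j, with i fixed, is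
    the one that yields the compatibility conditions.\<close>
  have swap: "partial k (partial i (partial j r)) u = partial j (partial i (partial k r)) u" if u: "u \<in> U" for u i j k
  proof -
    have "partial k (partial i (partial j r)) u = partial k (partial j (partial i r)) u"
      by (rule partial_cong_open[OF U u]) (rule partial_commute[OF U r_smooth])
    also have "\<dots> = partial j (partial k (partial i r)) u"
      by (rule partial_commute[OF U smooth_on_partial[OF r_smooth] u])
    also have "\<dots> = partial j (partial i (partial k r)) u"
      by (rule partial_cong_open[OF U u]) (rule partial_commute[OF U r_smooth])
    finally show ?thesis .
  qed
  show ?thesis
  proof (rule split_gauss_codazzi[OF U assms h_smooth h_symmetric(1)])
    fix u i j k assume u: "u \<in> U"
    note eq = swap[OF u, of k i j, unfolded third_derivative[OF u]]
    show "(\<Sum>s\<in>UNIV. h s i j u * \<eta> $ s $ k) = (\<Sum>s\<in>UNIV. h s i k u * \<eta> $ s $ j)"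
      using eq by (rule frame_coefficients_unique(2)[OF dim hyp u])
    show "partial k (h s i j) u + (\<Sum>p\<in>UNIV. h p i j u * h s p k u) + \<eta> $ i $ j * delta s k
      = partial j (h s i k) u + (\<Sum>p\<in>UNIV. h p i k u * h s p j u) + \<eta> $ i $ k * delta s j" for s
      using eq by (rule frame_coefficients_unique(1)[OF dim hyp u])
  qed
qed

end

section \<open>The potential\<close>

lemma partial3_symmetric:
  fixes f :: "real^'n::finite \<Rightarrow> real"
  assumes "open U" "smooth_on U f" "u \<in> U"
  shows "partial i (partial j (partial k f)) u = partial j (partial i (partial k f)) u"
    and "partial i (partial j (partial k f)) u = partial i (partial k (partial j f)) u"
  by (rule partial_commute_real[OF assms(1) smooth_on_partial[OF assms(2)] assms(3)])
    (rule partial_cong_open[OF assms(1,3) partial_commute_real[OF assms(1,2)]])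

lemma codazzi_potential:
  fixes \<eta> :: "real^'n::finite^'n" and h :: "'n tensor12"
  assumes U: "open U" "simply_connected U" and \<eta>: "transpose \<eta> = \<eta>" "invertible \<eta>"
    and h: "\<And>s i j. smooth_on U (h s i j)" and hs: "\<And>u s i j. u \<in> U \<Longrightarrow> h s i j u = h s j i u"
    and gc: "gauss_codazzi U (\<lambda>_. \<eta>) h"
  obtains f where "smooth_on U f" "h_from_potential U \<eta> h f"
proof -
  define H where "H i j k v = (\<Sum>s\<in>UNIV. \<eta> $ k $ s * h s i j v)" for i j k v
  note \<eta>s = symmetric_matrix_component[OF \<eta>(1)]
  have H_low: "H i j k v = (\<Sum>s\<in>UNIV. h s i j v * \<eta> $ s $ k)" for i j k v
    unfolding H_def by (rule sum.cong) (use \<eta>s[of k] in \<open>simp_all add: mult.commute\<close>)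
  have H_sym: "H i j k v = H j i k v" "H i j k v = H i k j v" if "v \<in> U" for i j k v
    using gc hs[OF that] that unfolding H_low gauss_codazzi_constant by auto
  have H_smooth: "smooth_on U (H i j k)" for i j k
    unfolding H_def by (intro smooth_on_sum smooth_on_mult smooth_on_const U h)
  have dH: "partial l (H i j k) u = (\<Sum>s\<in>UNIV. \<eta> $ k $ s * partial l (h s i j) u)" if "u \<in> U" for l i j k u
    unfolding H_def
    by (subst partial_sum) (use smooth_on_differentiable[OF h that] in \<open>auto simp: partial_cmult\<close>)
  have dH_cod: "partial l (H i j k) u = partial j (H i l k) u" if "u \<in> U" for l i j k u
    using gc that unfolding dH[OF that] gauss_codazzi_constant by simp
  have dH_sym: "partial l (H i j k) u = partial l (H i k j) u" if "u \<in> U" for l i j k u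
    by (rule partial_cong_open[OF U(1) that]) (rule H_sym(2))
  \<comment> \<open>The Codazzi equation exchanges the differentiation index with a lower index of
    h, and the symmetry of \<open>H\<close> moves that index to the last place. So for fixed i and j
    the form with coefficients H_ijk is closed.\<close>
  have closed: "partial l (H i j k) u = partial k (H i j l) u" if u: "u \<in> U" for l i j k u
    using dH_sym[OF u, of l i j k] dH_cod[OF u, of l i k j] dH_sym[OF u, of k i l j] by simp
  have "\<forall>i j. \<exists>g. smooth_on U g \<and> (\<forall>u\<in>U. \<forall>k. partial k g u = H i j k u)"
    by (intro allI closed_form_exact[OF U H_smooth] closed)
  then obtain \<phi> where \<phi>: "\<And>i j. smooth_on U (\<phi> i j)" "\<And>u i j k. u \<in> U \<Longrightarrow> partial k (\<phi> i j) u = H i j k u"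
    by metis
  \<comment> \<open>The functions \<open>\<phi> i j\<close> and \<open>\<phi> j i\<close> have equal
    differentials but may differ by a constant. Their average keeps the differential and is
    symmetric in i and j, which is what makes the form with coefficients \<open>\<psi> i\<close>
    closed below.\<close>
  define \<phi>' where "\<phi>' i j u = 1/2 * \<phi> i j u + 1/2 * \<phi> j i u" for i j u
  have \<phi>'_smooth: "smooth_on U (\<phi>' i j)" for i j
    unfolding \<phi>'_def by (intro smooth_on_add smooth_on_mult smooth_on_const U \<phi>)
  have \<phi>'_sym: "\<phi>' i j = \<phi>' j i" for i j
    by (simp add: \<phi>'_def fun_eq_iff)
  have d\<phi>': "partial k (\<phi>' i j) u = H i j k u" if u: "u \<in> U" for i j k u
  proof -
    have d: "\<phi> a b differentiable (at u)" for a b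
      by (rule smooth_on_differentiable[OF \<phi>(1) u])
    have "partial k (\<phi>' i j) u = 1/2 * partial k (\<phi> i j) u + 1/2 * partial k (\<phi> j i) u"
      unfolding \<phi>'_def by (simp only: partial_add partial_cmult d differentiable_mult differentiable_const)
    then show ?thesis using H_sym(1)[OF u, of j i k] by (simp add: \<phi>(2)[OF u])
  qed
  have "\<forall>i. \<exists>g. smooth_on U g \<and> (\<forall>u\<in>U. \<forall>j. partial j g u = \<phi>' i j u)"
  proof
    fix i
    have "partial k (\<phi>' i j) u = partial j (\<phi>' i k) u" if u: "u \<in> U" for u j k
      by (simp add: d\<phi>'[OF u] H_sym(2)[OF u, of i j k])
    then show "\<exists>g. smooth_on U g \<and> (\<forall>u\<in>U. \<forall>j. partial j g u = \<phi>' i j u)"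
      by (intro closed_form_exact[OF U \<phi>'_smooth])
  qed
  then obtain \<psi> where \<psi>: "\<And>i. smooth_on U (\<psi> i)" "\<And>u i j. u \<in> U \<Longrightarrow> partial j (\<psi> i) u = \<phi>' i j u"
    by metis
  have "partial j (\<psi> i) u = partial i (\<psi> j) u" if u: "u \<in> U" for u i j
    by (simp add: \<psi>(2)[OF u] \<phi>'_sym[of i j])
  from closed_form_exact[OF U \<psi>(1) this]
  obtain f where f: "smooth_on U f" "\<And>x i. x \<in> U \<Longrightarrow> partial i f x = \<psi> i x"
    by blast
  have f2: "partial j (partial k f) u = \<phi>' k j u" if u: "u \<in> U" for u j k
    using partial_cong_open[OF U(1) u f(2)] \<psi>(2)[OF u] by simp
  have f3: "partial i (partial j (partial k f)) u = H i j k u" if u: "u \<in> U" for u i j k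
    using partial_cong_open[OF U(1) u f2] d\<phi>'[OF u]
      H_sym(1)[OF u, of k j i] H_sym(2)[OF u, of j k i] H_sym(1)[OF u, of j i k] by simp
  have "h_from_potential U \<eta> h f"
    unfolding h_from_potential_def
  proof (intro ballI allI)
    fix u s i j assume u: "u \<in> U"
    show "h s i j u = (\<Sum>k\<in>UNIV. matrix_inv \<eta> $ s $ k * partial i (partial j (partial k f)) u)"
      unfolding f3[OF u] H_def by (rule raise_lower_index(1)[OF \<eta>(2), symmetric])
  qed
  with f(1) show thesis by (rule that)
qed

text \<open>The candidate tensor determined by a potential, as a total function; a given h is
  required to agree with it on U only.\<close>

definition potential_h :: "real^'n::finite^'n \<Rightarrow> (real^'n \<Rightarrow> real) \<Rightarrow> 'n tensor12" where
  "potential_h \<eta> f s i j u = (\<Sum>k\<in>UNIV. matrix_inv \<eta> $ s $ k * partial i (partial j (partial k f)) u)"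

lemma lower_potential_h:
  assumes "transpose \<eta> = \<eta>" "invertible \<eta>"
  shows "(\<Sum>s\<in>UNIV. potential_h \<eta> f s i j u * \<eta> $ s $ k) = partial i (partial j (partial k f)) u"
proof -
  have "(\<Sum>s\<in>UNIV. potential_h \<eta> f s i j u * \<eta> $ s $ k) = (\<Sum>s\<in>UNIV. \<eta> $ k $ s * potential_h \<eta> f s i j u)"
    by (rule sum.cong) (use symmetric_matrix_component[OF assms(1), of k] in \<open>simp_all add: mult.commute\<close>)
  then show ?thesis
    unfolding potential_h_def raise_lower_index(2)[OF assms(2)] .
qed

lemma potential_h_symmetric:
  assumes "open U" "smooth_on U f" "u \<in> U"
  shows "potential_h \<eta> f s i j u = potential_h \<eta> f s j i u"
  unfolding potential_h_def using partial3_symmetric(1)[OF assms, of i j] by simp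

text \<open>For a tensor with a potential, the first equation is symmetry of the third derivatives
  of f and the Codazzi equation that of the fourth. Only the Gauss equation is left. Its metric
  terms are arranged so that the two sides are the e_s-components of (e_i e_j) e_k and (e_i e_k)
  e_j.\<close>

lemma gauss_codazzi_potential_h:
  fixes \<eta> :: "real^'n::finite^'n"
  assumes U: "open U" and \<eta>: "transpose \<eta> = \<eta>" "invertible \<eta>" and f: "smooth_on U f"
    and h: "h_from_potential U \<eta> h f"
  shows "gauss_codazzi U (\<lambda>_. \<eta>) h \<longleftrightarrow>
    (\<forall>u\<in>U. \<forall>s i j k.
       (\<Sum>p\<in>UNIV. potential_h \<eta> f p i j u * potential_h \<eta> f s p k u) + \<eta> $ i $ j * delta s k
       = (\<Sum>p\<in>UNIV. potential_h \<eta> f p i k u * potential_h \<eta> f s p j u) + \<eta> $ i $ k * delta s j)"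
proof -
  have h_eq: "h s i j u = potential_h \<eta> f s i j u" if "u \<in> U" for s i j u
    using h that by (simp add: h_from_potential_def potential_h_def)
  have low: "(\<Sum>s\<in>UNIV. h s i j u * \<eta> $ s $ k) = (\<Sum>s\<in>UNIV. h s i k u * \<eta> $ s $ j)" if u: "u \<in> U" for u i j k
    unfolding h_eq[OF u] lower_potential_h[OF \<eta>] by (rule partial3_symmetric(2)[OF U f u])
  have cod: "partial k (h s i j) u = partial j (h s i k) u" if u: "u \<in> U" for u s i j k
  proof -
    have d: "partial a (h s i b) u
        = (\<Sum>m\<in>UNIV. matrix_inv \<eta> $ s $ m * partial a (partial i (partial b (partial m f))) u)" for a b
    proof -
      have "partial a (h s i b) u
          = partial a (\<lambda>v. \<Sum>m\<in>UNIV. matrix_inv \<eta> $ s $ m * partial i (partial b (partial m f)) v) u"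
        by (rule partial_cong_open[OF U u]) (simp add: h_eq potential_h_def)
      also have "\<dots> = (\<Sum>m\<in>UNIV. matrix_inv \<eta> $ s $ m * partial a (partial i (partial b (partial m f))) u)"
        using smooth_on_differentiable[OF smooth_on_partial[OF smooth_on_partial[OF smooth_on_partial[OF f]]] u]
        by (subst partial_sum) (auto simp: partial_cmult)
      finally show ?thesis .
    qed
    have "partial k (partial i (partial j (partial m f))) u = partial j (partial i (partial k (partial m f))) u" for m
      using partial3_symmetric[OF U smooth_on_partial[OF f] u] by metis
    then show ?thesis by (simp add: d)
  qed
  have "(\<Sum>p\<in>UNIV. h p i j u * h s p k u) - (\<Sum>p\<in>UNIV. h p i k u * h s p j u)
        = \<eta> $ i $ k * delta s j - \<eta> $ i $ j * delta s k \<longleftrightarrow>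
       (\<Sum>p\<in>UNIV. potential_h \<eta> f p i j u * potential_h \<eta> f s p k u) + \<eta> $ i $ j * delta s k
       = (\<Sum>p\<in>UNIV. potential_h \<eta> f p i k u * potential_h \<eta> f s p j u) + \<eta> $ i $ k * delta s j"
    if u: "u \<in> U" for u s i j k
    unfolding h_eq[OF u] by argo
  then show ?thesis
    unfolding gauss_codazzi_constant using low cod by blast
qed

section \<open>Derivatives of the prepotential\<close>

abbreviation spatial :: "real^('n::finite option) \<Rightarrow> real^'n" where
  "spatial w \<equiv> \<chi> i. w $ Some i"

section \<open>Differentiation in the variables u^0, ..., u^n\<close>

lemma bounded_linear_spatial: "bounded_linear spatial"
  by (intro linear_conv_bounded_linear[THEN iffD1] linearI) (simp_all add: vec_eq_iff)

lemma open_prepotential_domain: "open U \<Longrightarrow> open (prepotential_domain U)"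
  unfolding prepotential_domain_def
  using open_vimage[OF _ bounded_linear.continuous_on[OF bounded_linear_spatial continuous_on_id]]
  by (simp add: vimage_def)

lemma spatial_axis: "spatial (axis None 1) = 0" "spatial (axis (Some k) 1) = axis k 1"
  by (auto simp: vec_eq_iff axis_def)

lemma has_derivative_component: "((\<lambda>w. w $ a) has_derivative (\<lambda>v. v $ a)) F"
  by (rule bounded_linear.has_derivative[OF bounded_linear_vec_nth has_derivative_ident])

lemma partial_component_self: "partial a (\<lambda>w. w $ b :: real) w = delta a b"
  by (subst partial_eqI[OF has_derivative_component]) (simp add: axis_def delta_def)

lemma differentiable_component: "(\<lambda>w. w $ a :: real) differentiable F"
  using has_derivative_component differentiable_def by blast

lemma has_derivative_spatial:
  assumes "g differentiable (at (spatial w))"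
  shows "((\<lambda>w. g (spatial w)) has_derivative (\<lambda>v. frechet_derivative g (at (spatial w)) (spatial v))) (at w)"
  by (rule has_derivative_compose[OF bounded_linear_imp_has_derivative[OF bounded_linear_spatial]])
    (use assms frechet_derivative_works in blast)

lemma partial_spatial:
  assumes "g differentiable (at (spatial w))"
  shows "partial None (\<lambda>w. g (spatial w)) w = 0"
    and "partial (Some k) (\<lambda>w. g (spatial w)) w = partial k g (spatial w)"
  using partial_eqI[OF has_derivative_spatial[OF assms]]
    linear_0[OF linear_frechet_derivative[OF assms]]
  by (simp_all add: spatial_axis partial_def)

lemma differentiable_spatial:
  "g differentiable (at (spatial w)) \<Longrightarrow> (\<lambda>w. g (spatial w)) differentiable (at w)"
  using has_derivative_spatial differentiable_def by blast

lemma partial_mult: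
  fixes f g :: "real^'n::finite \<Rightarrow> real"
  assumes "f differentiable (at u)" "g differentiable (at u)"
  shows "partial i (\<lambda>v. f v * g v) u = f u * partial i g u + partial i f u * g u"
  using partial_scaleR[OF assms] by simp

lemma linear_form_has_derivative:
  fixes a :: "'n::finite \<Rightarrow> real"
  shows "((\<lambda>w. \<Sum>j\<in>UNIV. a j * w $ Some j) has_derivative (\<lambda>v. \<Sum>j\<in>UNIV. a j * v $ Some j)) (at w)"
  by (intro has_derivative_sum has_derivative_mult_right has_derivative_component)

lemma partial_linear_form:
  fixes a :: "'n::finite \<Rightarrow> real"
  shows "partial None (\<lambda>w. \<Sum>j\<in>UNIV. a j * w $ Some j) w = 0"
    and "partial (Some k) (\<lambda>w. \<Sum>j\<in>UNIV. a j * w $ Some j) w = a k"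
  by (simp_all add: partial_eqI[OF linear_form_has_derivative] axis_def if_distrib cong: if_cong)

lemma differentiable_linear_form:
  fixes a :: "'n::finite \<Rightarrow> real"
  shows "(\<lambda>w. \<Sum>j\<in>UNIV. a j * w $ Some j) differentiable (at w)"
  using linear_form_has_derivative differentiable_def by blast

text \<open>Symmetry of the matrix merges the two sums of the product rule; the resulting factor 2
  cancels the 1/2 in F.\<close>

lemma quadratic_form_has_derivative:
  fixes \<eta> :: "real^'n::finite^'n"
  assumes "transpose \<eta> = \<eta>"
  shows "((\<lambda>w. \<Sum>i\<in>UNIV. \<Sum>j\<in>UNIV. \<eta> $ i $ j * w $ Some i * w $ Some j) has_derivative
    (\<lambda>v. 2 * (\<Sum>i\<in>UNIV. v $ Some i * (\<Sum>j\<in>UNIV. \<eta> $ i $ j * w $ Some j)))) (at w)"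
proof -
  have "((\<lambda>w. \<Sum>i\<in>UNIV. \<Sum>j\<in>UNIV. \<eta> $ i $ j * w $ Some i * w $ Some j) has_derivative
    (\<lambda>v. \<Sum>i\<in>UNIV. \<Sum>j\<in>UNIV. \<eta> $ i $ j * w $ Some i * v $ Some j + \<eta> $ i $ j * v $ Some i * w $ Some j)) (at w)"
    by (intro has_derivative_sum has_derivative_mult has_derivative_mult_right has_derivative_component)
  moreover have "(\<Sum>i\<in>UNIV. \<Sum>j\<in>UNIV. \<eta> $ i $ j * w $ Some i * v $ Some j + \<eta> $ i $ j * v $ Some i * w $ Some j)
      = 2 * (\<Sum>i\<in>UNIV. v $ Some i * (\<Sum>j\<in>UNIV. \<eta> $ i $ j * w $ Some j))" for v
  proof -
    have "(\<Sum>i\<in>UNIV. \<Sum>j\<in>UNIV. \<eta> $ i $ j * w $ Some i * v $ Some j)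
        = (\<Sum>j\<in>UNIV. \<Sum>i\<in>UNIV. \<eta> $ i $ j * w $ Some i * v $ Some j)"
      by (rule sum.swap)
    also have "\<dots> = (\<Sum>i\<in>UNIV. \<Sum>j\<in>UNIV. \<eta> $ i $ j * v $ Some i * w $ Some j)"
      by (intro sum.cong refl) (use symmetric_matrix_component[OF assms] in \<open>simp add: mult_ac\<close>)
    finally show ?thesis
      by (simp add: sum.distrib sum_distrib_left mult_ac)
  qed
  ultimately show ?thesis by simp
qed

lemma partial_quadratic_form:
  fixes \<eta> :: "real^'n::finite^'n"
  assumes "transpose \<eta> = \<eta>"
  shows "partial None (\<lambda>w. \<Sum>i\<in>UNIV. \<Sum>j\<in>UNIV. \<eta> $ i $ j * w $ Some i * w $ Some j) w = 0"
    and "partial (Some k) (\<lambda>w. \<Sum>i\<in>UNIV. \<Sum>j\<in>UNIV. \<eta> $ i $ j * w $ Some i * w $ Some j) w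
      = 2 * (\<Sum>j\<in>UNIV. \<eta> $ k $ j * w $ Some j)"
  using partial_eqI[OF quadratic_form_has_derivative[OF assms]]
  by (simp_all add: axis_def if_distrib[of "\<lambda>x. x * _"] cong: if_cong)

locale prepotential_data =
  fixes U :: "(real^'n::finite) set" and \<eta> :: "real^'n^'n" and f :: "real^'n \<Rightarrow> real"
  assumes U: "open U" and \<eta>: "transpose \<eta> = \<eta>" "invertible \<eta>" and f: "smooth_on U f"
begin

abbreviation "W \<equiv> prepotential_domain U"
abbreviation "F \<equiv> prepotential \<eta> f"

lemma W: "open W" "w \<in> W \<Longrightarrow> spatial w \<in> U"
  using open_prepotential_domain[OF U] by (auto simp: prepotential_domain_def)

lemma f_differentiable:
  assumes "w \<in> W"
  shows "f differentiable (at (spatial w))" "partial k f differentiable (at (spatial w))"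
    "partial j (partial k f) differentiable (at (spatial w))"
  using smooth_on_differentiable[OF _ W(2)[OF assms]] smooth_on_partial f by blast+

text \<open>With u^0 taken out of the double sum, the product rule separates it from a quadratic
  form in the remaining variables.\<close>

lemma prepotential_alt:
  "F w = 1/6 * (w $ None * w $ None * w $ None)
    + 1/2 * (w $ None * (\<Sum>i\<in>UNIV. \<Sum>j\<in>UNIV. \<eta> $ i $ j * w $ Some i * w $ Some j)) + f (spatial w)"
  by (simp add: prepotential_def sum_distrib_left power3_eq_cube mult_ac)

lemma partial1:
  assumes w: "w \<in> W"
  shows "partial None F w = 1/2 * (w $ None * w $ None)
      + 1/2 * (\<Sum>i\<in>UNIV. \<Sum>j\<in>UNIV. \<eta> $ i $ j * w $ Some i * w $ Some j)"
    and "partial (Some k) F w = w $ None * (\<Sum>j\<in>UNIV. \<eta> $ k $ j * w $ Some j) + partial k f (spatial w)"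
proof -
  have q: "(\<lambda>w. \<Sum>i\<in>UNIV. \<Sum>j\<in>UNIV. \<eta> $ i $ j * w $ Some i * w $ Some j) differentiable (at w)"
    using quadratic_form_has_derivative[OF \<eta>(1)] differentiable_def by blast
  have "partial a F w = 1/6 * partial a (\<lambda>w. w $ None * w $ None * w $ None) w
      + 1/2 * (w $ None * partial a (\<lambda>w. \<Sum>i\<in>UNIV. \<Sum>j\<in>UNIV. \<eta> $ i $ j * w $ Some i * w $ Some j) w
          + delta a None * (\<Sum>i\<in>UNIV. \<Sum>j\<in>UNIV. \<eta> $ i $ j * w $ Some i * w $ Some j))
      + partial a (\<lambda>w. f (spatial w)) w" for a
    unfolding prepotential_alt[abs_def]
    by (simp only: partial_add partial_cmult partial_mult partial_component_self differentiable_component q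
        differentiable_spatial[OF f_differentiable(1)[OF w]] differentiable_add differentiable_mult differentiable_const)
  then show "partial None F w = 1/2 * (w $ None * w $ None)
      + 1/2 * (\<Sum>i\<in>UNIV. \<Sum>j\<in>UNIV. \<eta> $ i $ j * w $ Some i * w $ Some j)"
    and "partial (Some k) F w = w $ None * (\<Sum>j\<in>UNIV. \<eta> $ k $ j * w $ Some j) + partial k f (spatial w)"
    by (simp_all add: partial_mult partial_component_self differentiable_component differentiable_mult
        partial_quadratic_form[OF \<eta>(1)] partial_spatial f_differentiable[OF w] delta_def)
qed

lemma partial2:
  assumes w: "w \<in> W"
  shows "partial None (partial None F) w = w $ None"
    and "partial (Some k) (partial None F) w = (\<Sum>j\<in>UNIV. \<eta> $ k $ j * w $ Some j)"
    and "partial None (partial (Some k) F) w = (\<Sum>j\<in>UNIV. \<eta> $ k $ j * w $ Some j)"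
    and "partial (Some l) (partial (Some k) F) w = \<eta> $ k $ l * w $ None + partial l (partial k f) (spatial w)"
proof -
  have q: "(\<lambda>w. \<Sum>i\<in>UNIV. \<Sum>j\<in>UNIV. \<eta> $ i $ j * w $ Some i * w $ Some j) differentiable (at w)"
    using quadratic_form_has_derivative[OF \<eta>(1)] differentiable_def by blast
  have None: "partial a (partial None F) w = partial a (\<lambda>w. 1/2 * (w $ None * w $ None)
      + 1/2 * (\<Sum>i\<in>UNIV. \<Sum>j\<in>UNIV. \<eta> $ i $ j * w $ Some i * w $ Some j)) w" for a
    by (rule partial_cong_open[OF W(1) w partial1(1)])
  have Some: "partial a (partial (Some k) F) w
      = partial a (\<lambda>w. w $ None * (\<Sum>j\<in>UNIV. \<eta> $ k $ j * w $ Some j) + partial k f (spatial w)) w" for a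
    by (rule partial_cong_open[OF W(1) w partial1(2)])
  have "partial a (partial None F) w = 1/2 * (w $ None * delta a None + delta a None * w $ None)
      + 1/2 * partial a (\<lambda>w. \<Sum>i\<in>UNIV. \<Sum>j\<in>UNIV. \<eta> $ i $ j * w $ Some i * w $ Some j) w" for a
    unfolding None
    by (simp only: partial_add partial_cmult partial_mult partial_component_self differentiable_component
        differentiable_mult differentiable_const q)
  then show "partial None (partial None F) w = w $ None"
    and "partial (Some k) (partial None F) w = (\<Sum>j\<in>UNIV. \<eta> $ k $ j * w $ Some j)"
    by (simp_all add: partial_quadratic_form[OF \<eta>(1)] delta_def)
  show "partial None (partial (Some k) F) w = (\<Sum>j\<in>UNIV. \<eta> $ k $ j * w $ Some j)"
    and "partial (Some l) (partial (Some k) F) w = \<eta> $ k $ l * w $ None + partial l (partial k f) (spatial w)"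
    unfolding Some
    by (simp_all add: partial_add partial_mult partial_component_self differentiable_component
        differentiable_mult differentiable_linear_form partial_linear_form
        differentiable_spatial partial_spatial f_differentiable[OF w] delta_def)
qed

text \<open>None of these values involves u^0 any more, so the algebra at a point depends only on
  its spatial part.\<close>

lemma partial3:
  assumes w: "w \<in> W"
  shows "partial None (partial None (partial None F)) w = 1"
    "partial (Some k) (partial None (partial None F)) w = 0"
    "partial None (partial (Some k) (partial None F)) w = 0"
    "partial None (partial None (partial (Some k) F)) w = 0"
    "partial (Some l) (partial (Some k) (partial None F)) w = \<eta> $ k $ l"
    "partial (Some l) (partial None (partial (Some k) F)) w = \<eta> $ k $ l"
    "partial None (partial (Some l) (partial (Some k) F)) w = \<eta> $ k $ l"
    "partial (Some m) (partial (Some l) (partial (Some k) F)) w = partial m (partial l (partial k f)) (spatial w)"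
  by (simp_all add: partial_cong_open[OF W(1) w partial2(1)] partial_cong_open[OF W(1) w partial2(2)]
      partial_cong_open[OF W(1) w partial2(3)] partial_cong_open[OF W(1) w partial2(4)]
      partial_component_self partial_linear_form delta_def partial_add partial_cmult
      differentiable_component differentiable_mult differentiable_spatial partial_spatial f_differentiable[OF w])

end

section \<open>Associativity\<close>

lemma sum_swap4:
  fixes g :: "'a::finite \<Rightarrow> 'b::finite \<Rightarrow> 'c::finite \<Rightarrow> 'd::finite \<Rightarrow> real"
  shows "(\<Sum>p\<in>UNIV. \<Sum>e\<in>UNIV. \<Sum>b\<in>UNIV. \<Sum>d\<in>UNIV. g p e b d)
    = (\<Sum>b\<in>UNIV. \<Sum>d\<in>UNIV. \<Sum>e\<in>UNIV. \<Sum>p\<in>UNIV. g p e b d)"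
proof -
  have "(\<Sum>p\<in>UNIV. \<Sum>e\<in>UNIV. \<Sum>b\<in>UNIV. \<Sum>d\<in>UNIV. g p e b d)
      = (\<Sum>e\<in>UNIV. \<Sum>p\<in>UNIV. \<Sum>b\<in>UNIV. \<Sum>d\<in>UNIV. g p e b d)"
    by (rule sum.swap)
  also have "\<dots> = (\<Sum>e\<in>UNIV. \<Sum>b\<in>UNIV. \<Sum>p\<in>UNIV. \<Sum>d\<in>UNIV. g p e b d)"
    by (intro sum.cong refl sum.swap)
  also have "\<dots> = (\<Sum>e\<in>UNIV. \<Sum>b\<in>UNIV. \<Sum>d\<in>UNIV. \<Sum>p\<in>UNIV. g p e b d)"
    by (intro sum.cong refl sum.swap)
  also have "\<dots> = (\<Sum>b\<in>UNIV. \<Sum>e\<in>UNIV. \<Sum>d\<in>UNIV. \<Sum>p\<in>UNIV. g p e b d)"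
    by (rule sum.swap)
  also have "\<dots> = (\<Sum>b\<in>UNIV. \<Sum>d\<in>UNIV. \<Sum>e\<in>UNIV. \<Sum>p\<in>UNIV. g p e b d)"
    by (intro sum.cong refl sum.swap)
  finally show ?thesis .
qed

lemma algebra_mult_axis:
  "algebra_mult c (axis b 1) y $ a = (\<Sum>d\<in>UNIV. c a b d * y $ d)"
  "algebra_mult c x (axis d 1) $ a = (\<Sum>b\<in>UNIV. c a b d * x $ b)"
proof -
  have "(\<Sum>d\<in>UNIV. c a b' d * axis b 1 $ b' * y $ d) = (if b' = b then \<Sum>d\<in>UNIV. c a b' d * y $ d else 0)" for b'
    by (simp add: axis_def)
  then show "algebra_mult c (axis b 1) y $ a = (\<Sum>d\<in>UNIV. c a b d * y $ d)"
    by (simp add: algebra_mult_def)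
  have "(\<Sum>d'\<in>UNIV. c a b d' * x $ b * axis d 1 $ d') = c a b d * x $ b" for b
    by (simp add: axis_def if_distrib cong: if_cong)
  then show "algebra_mult c x (axis d 1) $ a = (\<Sum>b\<in>UNIV. c a b d * x $ b)"
    by (simp add: algebra_mult_def)
qed

text \<open>Both laws are multilinear in their arguments, so it is enough to test them on basis
  vectors.\<close>

lemma comm_assoc_structure_constants_iff:
  "comm_assoc_structure_constants c \<longleftrightarrow>
     (\<forall>a b d. c a b d = c a d b) \<and>
     (\<forall>a b d e. (\<Sum>p\<in>UNIV. c p b d * c a p e) = (\<Sum>p\<in>UNIV. c p d e * c a b p))"
  (is "_ \<longleftrightarrow> ?comm \<and> ?assoc")
proof
  assume L: "comm_assoc_structure_constants c"
  have axes: "algebra_mult c (axis b 1) (axis d 1) $ a = c a b d" for a b d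
    unfolding algebra_mult_axis by (simp add: axis_def if_distrib cong: if_cong)
  have ?comm
    using L axes unfolding comm_assoc_structure_constants_def by metis
  moreover have ?assoc
  proof (intro allI)
    fix a b d e
    have "algebra_mult c (algebra_mult c (axis b 1) (axis d 1)) (axis e 1) $ a
        = algebra_mult c (axis b 1) (algebra_mult c (axis d 1) (axis e 1)) $ a"
      using L unfolding comm_assoc_structure_constants_def by (intro arg_cong[where f = "\<lambda>v. v $ a"]) blast
    then have "(\<Sum>p\<in>UNIV. c a p e * c p b d) = (\<Sum>p\<in>UNIV. c a b p * c p d e)"
      unfolding algebra_mult_axis(2)[of c "algebra_mult c _ _"] algebra_mult_axis(1)[of c _ "algebra_mult c _ _"] axes .
    then show "(\<Sum>p\<in>UNIV. c p b d * c a p e) = (\<Sum>p\<in>UNIV. c p d e * c a b p)"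
      by (simp add: mult.commute)
  qed
  ultimately show "?comm \<and> ?assoc" by blast
next
  assume R: "?comm \<and> ?assoc"
  have "algebra_mult c x y = algebra_mult c y x" for x y
  proof -
    have "algebra_mult c x y $ a = algebra_mult c y x $ a" for a
    proof -
      have "(\<Sum>b\<in>UNIV. \<Sum>d\<in>UNIV. c a b d * x $ b * y $ d) = (\<Sum>d\<in>UNIV. \<Sum>b\<in>UNIV. c a b d * x $ b * y $ d)"
        by (rule sum.swap)
      also have "\<dots> = (\<Sum>d\<in>UNIV. \<Sum>b\<in>UNIV. c a d b * y $ d * x $ b)"
        by (intro sum.cong refl) (use R in simp)
      finally show ?thesis by (simp add: algebra_mult_def)
    qed
    then show ?thesis by (simp add: vec_eq_iff)
  qed
  moreover have "algebra_mult c (algebra_mult c x y) z = algebra_mult c x (algebra_mult c y z)" for x y z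
  proof -
    have "algebra_mult c (algebra_mult c x y) z $ a = algebra_mult c x (algebra_mult c y z) $ a" for a
    proof -
      have assoc: "(\<Sum>p\<in>UNIV. c p b d * c a p e) = (\<Sum>p\<in>UNIV. c p d e * c a b p)" for b d e
        using R by blast
      have "algebra_mult c (algebra_mult c x y) z $ a
          = (\<Sum>p\<in>UNIV. \<Sum>e\<in>UNIV. \<Sum>b\<in>UNIV. \<Sum>d\<in>UNIV. x $ b * y $ d * z $ e * (c p b d * c a p e))"
        by (simp add: algebra_mult_def sum_distrib_left sum_distrib_right mult_ac)
      also have "\<dots> = (\<Sum>b\<in>UNIV. \<Sum>d\<in>UNIV. \<Sum>e\<in>UNIV. x $ b * y $ d * z $ e * (\<Sum>p\<in>UNIV. c p b d * c a p e))"
        unfolding sum_distrib_left by (rule sum_swap4)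
      also have "\<dots> = (\<Sum>b\<in>UNIV. \<Sum>d\<in>UNIV. \<Sum>e\<in>UNIV. x $ b * y $ d * z $ e * (\<Sum>p\<in>UNIV. c p d e * c a b p))"
        by (simp only: assoc)
      also have "\<dots> = (\<Sum>b\<in>UNIV. \<Sum>d\<in>UNIV. \<Sum>e\<in>UNIV. \<Sum>p\<in>UNIV. x $ b * y $ d * z $ e * (c p d e * c a b p))"
        by (simp add: sum_distrib_left)
      also have "\<dots> = (\<Sum>b\<in>UNIV. \<Sum>d\<in>UNIV. \<Sum>p\<in>UNIV. \<Sum>e\<in>UNIV. x $ b * y $ d * z $ e * (c p d e * c a b p))"
        by (intro sum.cong refl sum.swap)
      also have "\<dots> = (\<Sum>b\<in>UNIV. \<Sum>p\<in>UNIV. \<Sum>d\<in>UNIV. \<Sum>e\<in>UNIV. x $ b * y $ d * z $ e * (c p d e * c a b p))"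
        by (intro sum.cong refl sum.swap)
      also have "\<dots> = algebra_mult c x (algebra_mult c y z) $ a"
        by (simp add: algebra_mult_def sum_distrib_left sum_distrib_right mult_ac)
      finally show ?thesis .
    qed
    then show ?thesis by (simp add: vec_eq_iff)
  qed
  ultimately show "comm_assoc_structure_constants c"
    unfolding comm_assoc_structure_constants_def by blast
qed

text \<open>The table of the algebra with unit e_0 and e_i e_j = eta_ij e_0 + h^s_ij e_s, with the
  upper index as the first of the three.\<close>

fun unital_structure :: "real^'n::finite^'n \<Rightarrow> ('n \<Rightarrow> 'n \<Rightarrow> 'n \<Rightarrow> real) \<Rightarrow>
    'n option \<Rightarrow> 'n option \<Rightarrow> 'n option \<Rightarrow> real" where
  "unital_structure \<eta> h None None None = 1"
| "unital_structure \<eta> h None None (Some j) = 0"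
| "unital_structure \<eta> h None (Some i) None = 0"
| "unital_structure \<eta> h None (Some i) (Some j) = \<eta> $ i $ j"
| "unital_structure \<eta> h (Some s) None None = 0"
| "unital_structure \<eta> h (Some s) None (Some j) = delta s j"
| "unital_structure \<eta> h (Some s) (Some i) None = delta s i"
| "unital_structure \<eta> h (Some s) (Some i) (Some j) = h s i j"

text \<open>Products involving the unit associate by themselves, and \<open>low\<close> is the
  e_0-component of the law for e_i, e_j, e_k. What remains are the e_s-components, which
  commutativity brings into the shape of the Gauss equation.\<close>

lemma unital_structure_assoc_iff:
  assumes \<eta>: "\<And>i j. \<eta> $ i $ j = \<eta> $ j $ i" and h: "\<And>s i j. h s i j = h s j i"
    and low: "\<And>i j k. (\<Sum>p\<in>UNIV. h p i j * \<eta> $ p $ k) = (\<Sum>p\<in>UNIV. h p j k * \<eta> $ i $ p)"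
  shows "comm_assoc_structure_constants (unital_structure \<eta> h) \<longleftrightarrow>
    (\<forall>s i j k. (\<Sum>p\<in>UNIV. h p i j * h s p k) + \<eta> $ i $ j * delta s k
        = (\<Sum>p\<in>UNIV. h p i k * h s p j) + \<eta> $ i $ k * delta s j)"
proof -
  let ?c = "unital_structure \<eta> h"
  have comm: "?c a b d = ?c a d b" for a b d
    by (cases a; cases b; cases d) (use \<eta> h in auto)
  \<comment> \<open>Besides the triples that contain the unit, this covers a = \<open>None\<close>
    with three spatial factors, where \<open>low\<close> is needed.\<close>
  have assoc: "(\<Sum>p\<in>UNIV. ?c p b d * ?c a p e) = (\<Sum>p\<in>UNIV. ?c p d e * ?c a b p)"
    if "a = None \<or> b = None \<or> d = None \<or> e = None" for a b d e
    using that
    by (cases a; cases b; cases d; cases e)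
      (auto simp: sum_option_UNIV sum_delta_mult low)
  have assoc_Some: "(\<Sum>p\<in>UNIV. ?c p (Some i) (Some j) * ?c (Some s) p (Some k))
      = (\<Sum>p\<in>UNIV. h p j i * h s p k) + \<eta> $ j $ i * delta s k"
    "(\<Sum>p\<in>UNIV. ?c p (Some j) (Some k) * ?c (Some s) (Some i) p)
      = (\<Sum>p\<in>UNIV. h p j k * h s p i) + \<eta> $ j $ k * delta s i" for s i j k
    by (simp_all add: sum_option_UNIV h[of _ i j] h[of s i] \<eta>[of i j])
  define X where "X a b d e \<longleftrightarrow> (\<Sum>p\<in>UNIV. ?c p b d * ?c a p e) = (\<Sum>p\<in>UNIV. ?c p d e * ?c a b p)" for a b d e
  have "comm_assoc_structure_constants ?c \<longleftrightarrow> (\<forall>a b d e. X a b d e)"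
    unfolding comm_assoc_structure_constants_iff X_def using comm by blast
  also have "\<dots> \<longleftrightarrow> (\<forall>s i j k. X (Some s) (Some i) (Some j) (Some k))"
  proof (intro iffI allI)
    fix a b d e assume *: "\<forall>s i j k. X (Some s) (Some i) (Some j) (Some k)"
    show "X a b d e"
    proof (cases "a = None \<or> b = None \<or> d = None \<or> e = None")
      case True
      then show ?thesis unfolding X_def by (rule assoc)
    next
      case False
      then obtain s i j k where "a = Some s" "b = Some i" "d = Some j" "e = Some k"
        by (auto simp: not_None_eq)
      with * show ?thesis by simp
    qed
  qed simp
  also have "\<dots> \<longleftrightarrow> (\<forall>s i j k. (\<Sum>p\<in>UNIV. h p j i * h s p k) + \<eta> $ j $ i * delta s k
      = (\<Sum>p\<in>UNIV. h p j k * h s p i) + \<eta> $ j $ k * delta s i)"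
    unfolding X_def assoc_Some by (rule refl)
  \<comment> \<open>Only the names of i and j are exchanged under the quantifiers.\<close>
  also have "\<dots> \<longleftrightarrow> (\<forall>s i j k. (\<Sum>p\<in>UNIV. h p i j * h s p k) + \<eta> $ i $ j * delta s k
        = (\<Sum>p\<in>UNIV. h p i k * h s p j) + \<eta> $ i $ k * delta s j)"
    by blast
  finally show ?thesis .
qed

section \<open>The metric and the structure functions of the prepotential\<close>

lemma matrix_inv_eqI:
  fixes A B :: "real^'k::finite^'k"
  assumes "A ** B = mat 1"
  shows "invertible A" "matrix_inv A = B"
proof -
  have BA: "B ** A = mat 1" using assms matrix_left_right_inverse by blast
  with assms show "invertible A" unfolding invertible_def by blast
  have "A ** matrix_inv A = mat 1 \<and> matrix_inv A ** A = mat 1"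
    unfolding matrix_inv_def by (rule someI[of _ B]) (use assms BA in blast)
  then have "matrix_inv A = matrix_inv A ** (A ** B)" by (simp add: assms)
  also have "\<dots> = B" using \<open>_ \<and> _\<close> by (simp add: matrix_mul_assoc)
  finally show "matrix_inv A = B" .
qed

definition unital_metric :: "real^'n::finite^'n \<Rightarrow> real^('n option)^('n option)" where
  "unital_metric \<eta> = (\<chi> a b. case a of None \<Rightarrow> (case b of None \<Rightarrow> 1 | Some j \<Rightarrow> 0)
     | Some i \<Rightarrow> (case b of None \<Rightarrow> 0 | Some j \<Rightarrow> \<eta> $ i $ j))"

lemma unital_metric_simps [simp]:
  "unital_metric \<eta> $ None $ None = 1" "unital_metric \<eta> $ None $ Some j = 0"
  "unital_metric \<eta> $ Some i $ None = 0" "unital_metric \<eta> $ Some i $ Some j = \<eta> $ i $ j"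
  by (simp_all add: unital_metric_def)

text \<open>The matrix is block diagonal with blocks 1 and eta, so it is inverted block by
  block.\<close>

lemma unital_metric_inverse:
  assumes "invertible \<eta>"
  shows "unital_metric \<eta> ** unital_metric (matrix_inv \<eta>) = mat 1"
proof -
  have "(\<Sum>c\<in>UNIV. unital_metric \<eta> $ a $ c * unital_metric (matrix_inv \<eta>) $ c $ b) = (if a = b then 1 else 0)" for a b
    by (cases a; cases b) (simp_all add: sum_option_UNIV matrix_inv_cancel[OF assms] delta_def)
  then show ?thesis by (simp add: vec_eq_iff matrix_matrix_mult_def mat_def)
qed

context prepotential_data
begin

lemma prepotential_metric_eq:
  assumes "w \<in> W"
  shows "prepotential_metric F w = unital_metric \<eta>"
proof -
  have "partial None (partial a (partial b F)) w = unital_metric \<eta> $ a $ b" for a b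
    by (cases a; cases b)
      (auto simp: partial3[OF assms] intro: symmetric_matrix_component[OF \<eta>(1)])
  then show ?thesis by (simp add: prepotential_metric_def vec_eq_iff)
qed

lemma structure_functions_eq:
  assumes "w \<in> W"
  shows "structure_functions F a b c w
    = unital_structure \<eta> (\<lambda>s i j. potential_h \<eta> f s i j (spatial w)) a b c"
proof -
  have "(\<Sum>k\<in>UNIV. matrix_inv \<eta> $ s $ k * \<eta> $ k $ j) = delta s j"
      "(\<Sum>k\<in>UNIV. matrix_inv \<eta> $ s $ k * \<eta> $ j $ k) = delta s j" for s j
    using matrix_inv_cancel(1)[OF \<eta>(2), of s j] symmetric_matrix_component[OF \<eta>(1), of j] by simp_all
  then show ?thesis
    unfolding structure_functions_def prepotential_metric_eq[OF assms]
      matrix_inv_eqI(2)[OF unital_metric_inverse[OF \<eta>(2)]] sum_option_UNIV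
    by (cases a; cases b; cases c)
      (auto simp: partial3[OF assms] potential_h_def intro: symmetric_matrix_component[OF \<eta>(1)])
qed

lemma associativity_equations_iff:
  "associativity_equations U \<eta> f \<longleftrightarrow>
    (\<forall>u\<in>U. \<forall>s i j k.
       (\<Sum>p\<in>UNIV. potential_h \<eta> f p i j u * potential_h \<eta> f s p k u) + \<eta> $ i $ j * delta s k
       = (\<Sum>p\<in>UNIV. potential_h \<eta> f p i k u * potential_h \<eta> f s p j u) + \<eta> $ i $ k * delta s j)"
proof -
  let ?G = "\<lambda>u. \<forall>s i j k.
       (\<Sum>p\<in>UNIV. potential_h \<eta> f p i j u * potential_h \<eta> f s p k u) + \<eta> $ i $ j * delta s k
       = (\<Sum>p\<in>UNIV. potential_h \<eta> f p i k u * potential_h \<eta> f s p j u) + \<eta> $ i $ k * delta s j"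
  have iff: "comm_assoc_structure_constants (\<lambda>a b c. structure_functions F a b c w) \<longleftrightarrow> ?G (spatial w)"
    if w: "w \<in> W" for w
    unfolding structure_functions_eq[OF w]
  proof (rule unital_structure_assoc_iff)
    note u = W(2)[OF w]
    show \<eta>s: "\<eta> $ i $ j = \<eta> $ j $ i" for i j by (rule symmetric_matrix_component[OF \<eta>(1)])
    show "potential_h \<eta> f s i j (spatial w) = potential_h \<eta> f s j i (spatial w)" for s i j
      by (rule potential_h_symmetric[OF U f u])
    have "(\<Sum>p\<in>UNIV. potential_h \<eta> f p j k (spatial w) * \<eta> $ i $ p)
        = (\<Sum>p\<in>UNIV. potential_h \<eta> f p j k (spatial w) * \<eta> $ p $ i)" for i j k
      by (simp add: \<eta>s[of i])
    then show "(\<Sum>p\<in>UNIV. potential_h \<eta> f p i j (spatial w) * \<eta> $ p $ k)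
        = (\<Sum>p\<in>UNIV. potential_h \<eta> f p j k (spatial w) * \<eta> $ i $ p)" for i j k
      unfolding lower_potential_h[OF \<eta>] using partial3_symmetric[OF U f u] by metis
  qed
  \<comment> \<open>Every point of U is the spatial part of a point of the domain of F; u^0 = 0 is
    an arbitrary choice. A condition on spatial parts thus passes from the domain of F to U.\<close>
  have "\<exists>w\<in>W. spatial w = u" if "u \<in> U" for u
  proof (rule bexI)
    let ?w = "(\<chi> a. case a of None \<Rightarrow> 0 | Some i \<Rightarrow> u $ i) :: real^('n option)"
    show "spatial ?w = u" by (simp add: vec_eq_iff)
    then show "?w \<in> W" using that by (simp add: prepotential_domain_def)
  qed
  then have "spatial ` W = U"
    using W(2) by (auto simp: image_iff)
  then have "(\<forall>u\<in>U. ?G u) \<longleftrightarrow> (\<forall>w\<in>W. ?G (spatial w))"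
    using ball_simps(9)[of spatial W ?G] by (simp only:)
  also have "\<dots> \<longleftrightarrow> associativity_equations U \<eta> f"
    unfolding associativity_equations_def by (intro ball_cong refl) (rule iff[symmetric])
  finally show ?thesis by (rule sym)
qed

end

section \<open>Surfaces\<close>

lemma eta_2dxdy_simps [simp]:
  "eta_2dxdy $ 1 $ 1 = 0" "eta_2dxdy $ 1 $ 2 = 1" "eta_2dxdy $ 2 $ 1 = 1" "eta_2dxdy $ 2 $ 2 = 0"
  by (simp_all add: eta_2dxdy_def vector_2)

lemma eta_2dxdy:
  "transpose eta_2dxdy = eta_2dxdy" "invertible eta_2dxdy" "matrix_inv eta_2dxdy = eta_2dxdy"
proof -
  have "eta_2dxdy ** eta_2dxdy = mat 1"
    by (simp add: vec_eq_iff matrix_matrix_mult_def mat_def forall_2 sum_2)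
  then show "invertible eta_2dxdy" "matrix_inv eta_2dxdy = eta_2dxdy"
    by (rule matrix_inv_eqI)+
  show "transpose eta_2dxdy = eta_2dxdy"
    by (simp add: vec_eq_iff transpose_def forall_2)
qed

text \<open>Raising an index with this metric exchanges 1 and 2, so h^1_ij and h^2_ij are the third
  derivatives of f with last index 2 and 1. Among the sixteen index choices those with j = k are
  trivial; for j and k distinct, i = s gives the stated equation, and i different from s gives an
  identity.\<close>

lemma associativity_2dxdy:
  assumes V: "open V" and f: "smooth_on V f"
  shows "associativity_equations V eta_2dxdy f \<longleftrightarrow>
    (\<forall>u\<in>V. partial 1 (partial 1 (partial 1 f)) u * partial 2 (partial 2 (partial 2 f)) u
       - partial 1 (partial 1 (partial 2 f)) u * partial 1 (partial 2 (partial 2 f)) u = 1)"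
proof -
  interpret prepotential_data V eta_2dxdy f
    by unfold_locales (use V f eta_2dxdy in auto)
  have "(\<forall>s i j k.
       (\<Sum>p\<in>UNIV. potential_h eta_2dxdy f p i j u * potential_h eta_2dxdy f s p k u) + eta_2dxdy $ i $ j * delta s k
       = (\<Sum>p\<in>UNIV. potential_h eta_2dxdy f p i k u * potential_h eta_2dxdy f s p j u) + eta_2dxdy $ i $ k * delta s j)
    \<longleftrightarrow> partial 1 (partial 1 (partial 1 f)) u * partial 2 (partial 2 (partial 2 f)) u
       - partial 1 (partial 1 (partial 2 f)) u * partial 1 (partial 2 (partial 2 f)) u = 1" if u: "u \<in> V" for u
  proof -
    note sym = partial3_symmetric[OF V f u]
    have h: "potential_h eta_2dxdy f 1 i j u = partial i (partial j (partial 2 f)) u"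
      "potential_h eta_2dxdy f 2 i j u = partial i (partial j (partial 1 f)) u" for i j
      by (simp_all add: potential_h_def eta_2dxdy sum_2)
    have p: "partial 1 (partial 2 (partial 1 f)) u = partial 1 (partial 1 (partial 2 f)) u"
      "partial 2 (partial 1 (partial 1 f)) u = partial 1 (partial 1 (partial 2 f)) u"
      "partial 2 (partial 1 (partial 2 f)) u = partial 1 (partial 2 (partial 2 f)) u"
      "partial 2 (partial 2 (partial 1 f)) u = partial 1 (partial 2 (partial 2 f)) u"
      using sym by metis+
    show ?thesis
      unfolding forall_2 sum_2 h p by (auto simp: delta_def algebra_simps)
  qed
  then show ?thesis unfolding associativity_equations_iff by blast
qed

lemma asymptotic_2dxdy:
  fixes r :: "real^2 \<Rightarrow> real^3"
  assumes "open V" "centroaffine_hypersurface V r" "\<forall>u\<in>V. centroaffine_metric r u = eta_2dxdy"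
  shows "asymptotic_coordinates V r"
proof -
  interpret flat_centroaffine V r eta_2dxdy
    by unfold_locales (use assms in auto)
  have "partial i (partial i r) u \<in> span (range (\<lambda>k. partial k r u))" if u: "u \<in> V" for u i
  proof -
    \<comment> \<open>A zero diagonal entry removes the component along r, which is the transversal
      one.\<close>
    have "eta_2dxdy $ i $ i = 0"
      using exhaust_2[of i] by auto
    then have "partial i (partial i r) u = (\<Sum>k\<in>UNIV. h k i i u *\<^sub>R partial k r u)"
      by (simp add: second_derivative[OF u])
    then show ?thesis
      by (simp only:) (intro span_sum span_scale span_base rangeI)
  qed
  then show ?thesis by (simp add: asymptotic_coordinates_def)
qed

theorem mainTheorem1:
  fixes U :: "(real^'n::finite) set" and \<eta> :: "real^'n^'n"
  assumes "CARD('n) \<ge> 2"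
    and "CARD('m::finite) = CARD('n) + 1"
    and "open U" and "U \<noteq> {}" and "simply_connected U"
    and "transpose \<eta> = \<eta>" and "invertible \<eta>"
  shows
    "(\<forall>r :: real^'n \<Rightarrow> real^'m.
        centroaffine_hypersurface U r \<and> (\<forall>u\<in>U. centroaffine_metric r u = \<eta>) \<longrightarrow>
        (\<exists>f. smooth_on U f \<and>
             h_from_potential U \<eta> (centroaffine_h r) f \<and>
             (\<exists>E. invertible E \<and>
                (\<forall>w\<in>prepotential_domain U. prepotential_metric (prepotential \<eta> f) w = E)) \<and>
             associativity_equations U \<eta> f)) \<and>
     (\<forall>h :: 'n tensor12.
        (\<forall>s i j. smooth_on U (h s i j)) \<and> (\<forall>u\<in>U. \<forall>s i j. h s i j u = h s j i u) \<longrightarrow>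
        (gauss_codazzi U (\<lambda>_. \<eta>) h \<longleftrightarrow>
         (\<exists>f. smooth_on U f \<and> h_from_potential U \<eta> h f \<and> associativity_equations U \<eta> f))) \<and>
     (\<forall>V :: (real^2) set. open V \<and> V \<noteq> {} \<and> simply_connected V \<longrightarrow>
        (\<forall>r :: real^2 \<Rightarrow> real^3.
           centroaffine_hypersurface V r \<and> (\<forall>u\<in>V. centroaffine_metric r u = eta_2dxdy) \<longrightarrow>
           asymptotic_coordinates V r) \<and>
        (\<forall>f. smooth_on V f \<longrightarrow>
           (associativity_equations V eta_2dxdy f \<longleftrightarrow>
            (\<forall>u\<in>V.
               partial 1 (partial 1 (partial 1 f)) u * partial 2 (partial 2 (partial 2 f)) u
               - partial 1 (partial 1 (partial 2 f)) u * partial 1 (partial 2 (partial 2 f)) u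
               = 1))))"
proof -
  \<comment> \<open>For any potential of h, both conditions are the same quadratic system in the
    third derivatives of f. The existence of a potential is a separate matter that rests on the
    Codazzi equations.\<close>
  have potential: "gauss_codazzi U (\<lambda>_. \<eta>) h \<longleftrightarrow> associativity_equations U \<eta> f"
    if "smooth_on U f" "h_from_potential U \<eta> h f" for h f
  proof -
    interpret prepotential_data U \<eta> f
      by unfold_locales (use assms that in auto)
    show ?thesis
      unfolding associativity_equations_iff by (rule gauss_codazzi_potential_h[OF U \<eta> that])
  qed
  have iff: "gauss_codazzi U (\<lambda>_. \<eta>) h \<longleftrightarrow>
         (\<exists>f. smooth_on U f \<and> h_from_potential U \<eta> h f \<and> associativity_equations U \<eta> f)"
    if h: "\<And>s i j. smooth_on U (h s i j)" "\<And>u s i j. u \<in> U \<Longrightarrow> h s i j u = h s j i u" for h :: "'n tensor12"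
  proof
    assume gc: "gauss_codazzi U (\<lambda>_. \<eta>) h"
    obtain f where f: "smooth_on U f" "h_from_potential U \<eta> h f"
      by (rule codazzi_potential[OF assms(3,5,6,7) h gc])
    with gc show "\<exists>f. smooth_on U f \<and> h_from_potential U \<eta> h f \<and> associativity_equations U \<eta> f"
      using potential by blast
  qed (use potential in blast)
  have "\<exists>f. smooth_on U f \<and> h_from_potential U \<eta> (centroaffine_h r) f \<and>
             (\<exists>E. invertible E \<and>
                (\<forall>w\<in>prepotential_domain U. prepotential_metric (prepotential \<eta> f) w = E)) \<and>
             associativity_equations U \<eta> f"
    if r: "centroaffine_hypersurface U r" "\<forall>u\<in>U. centroaffine_metric r u = \<eta>" for r :: "real^'n \<Rightarrow> real^'m"
  proof -
    interpret flat_centroaffine U r \<eta>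
      by unfold_locales (use assms r in auto)
    \<comment> \<open>The equivalence for abstract tensors applies to the hypersurface because its h
      is smooth and symmetric and satisfies the Gauss-Codazzi equations.\<close>
    obtain f where pot: "smooth_on U f" "h_from_potential U \<eta> h f" "associativity_equations U \<eta> f"
      using iff[of "centroaffine_h r", OF h_smooth h_symmetric(1)] gauss_codazzi_h[OF assms(6,7)] by blast
    interpret prepotential_data U \<eta> f
      by unfold_locales (use assms pot in auto)
    show ?thesis
      using pot prepotential_metric_eq matrix_inv_eqI(1)[OF unital_metric_inverse[OF \<eta>(2)]] by blast
  qed
  then show ?thesis
    using iff asymptotic_2dxdy associativity_2dxdy by simp
qed

end
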